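(* There exist a Martin-Löf random set of integers $R\subseteq\omega$ and an infinite subset $Y\subseteq R$ such that no Martin-Löf random set of integers is Turing computable from $Y$.
   Context: $\omega=\{0,1,2,\dots\}$; subsets of $\omega$ are identified with their characteristic functions, i.e. with elements of $2^\omega$ (reals). For a finite binary string $\sigma$, $[\sigma]\subseteq 2^\omega$ is the set of infinite extensions of $\sigma$, and for a set of strings $V$, $[V]^\preceq=\bigcup_{\sigma\in V}[\sigma]$. A set of integers (equivalently a real $x\in 2^\omega$, corresponding to $\{n:x(n)=1\}$) is Martin-Löf random if $x\notin\bigcap_n[U_n]^\preceq$ for every uniformly computably enumerable sequence $(U_n)_{n<\omega}$ of sets of binary strings such that $\sum_{w\in U_n}2^{-|w|}\le 2^{-n}$ for all $n$. *)

theory Defs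
  imports "HOL-Library.Nat_Bijection" "HOL-Analysis.Infinite_Sum"
begin

text \<open>
  Turing computability relative to an oracle, presented by programs for the partial recursive
  functions with an additional basic function, the characteristic function of the oracle.
  Elements of Cantor space are represented by the subsets of the natural numbers of which they
  are the characteristic functions.
\<close>

datatype prog =
    Zero
  | Succ
  | Proj nat
  | Oracle
  | Comp prog "prog list"
  | PrimRec prog prog
  | Mu prog

text \<open>
  \<open>eval A p xs y\<close>: the program \<open>p\<close> with oracle \<open>A\<close> halts on the argument list \<open>xs\<close> with output \<open>y\<close>.
  In \<open>PrimRec f g\<close> the recursion variable comes first; \<open>g\<close> receives the current value of the
  recursion variable, the previous result and then the parameters. In \<open>Mu f\<close> the search variable
  comes first, and the search diverges if \<open>f\<close> diverges before the first zero is found. A program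
  diverges on argument lists of unsuitable length.
\<close>

inductive eval :: "nat set \<Rightarrow> prog \<Rightarrow> nat list \<Rightarrow> nat \<Rightarrow> bool" for A :: "nat set" where
  eval_Zero: "eval A Zero xs 0"
| eval_Succ: "eval A Succ [x] (Suc x)"
| eval_Proj: "i < length xs \<Longrightarrow> eval A (Proj i) xs (xs ! i)"
| eval_Oracle: "eval A Oracle [x] (of_bool (x \<in> A))"
| eval_Comp: "list_all2 (\<lambda>g y. eval A g xs y) gs ys \<Longrightarrow> eval A f ys z \<Longrightarrow> eval A (Comp f gs) xs z"
| eval_PrimRec_0: "eval A f xs y \<Longrightarrow> eval A (PrimRec f g) (0 # xs) y"
| eval_PrimRec_Suc: "eval A (PrimRec f g) (n # xs) r \<Longrightarrow> eval A g (n # r # xs) y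
    \<Longrightarrow> eval A (PrimRec f g) (Suc n # xs) y"
| eval_Mu: "eval A f (n # xs) 0 \<Longrightarrow> (\<And>m. m < n \<Longrightarrow> \<exists>y>0. eval A f (m # xs) y)
    \<Longrightarrow> eval A (Mu f) xs n"

inductive_cases eval_elims:
  "eval A Zero xs y" "eval A Succ xs y" "eval A (Proj i) xs y" "eval A Oracle xs y"
  "eval A (Comp f gs) xs y" "eval A (PrimRec f g) (0 # xs) y" "eval A (PrimRec f g) (Suc n # xs) y"
  "eval A (Mu f) xs y"

lemma eval_deterministic: "eval A p xs y \<Longrightarrow> eval A p xs z \<Longrightarrow> y = z"
proof (induction arbitrary: z rule: eval.induct)
  case (eval_Comp xs gs ys f y)
  from eval_Comp.prems obtain ys' where
    ys': "list_all2 (\<lambda>g y. eval A g xs y) gs ys'" "eval A f ys' z"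
    by (rule eval_elims)
  have "ys = ys'"
  proof (rule nth_equalityI)
    show "length ys = length ys'"
      using list_all2_lengthD[OF eval_Comp.IH(1)] list_all2_lengthD[OF ys'(1)] by simp
    show "ys ! i = ys' ! i" if "i < length ys" for i
      using list_all2_nthD2[OF eval_Comp.IH(1) that] list_all2_nthD2[OF ys'(1), of i] that
        \<open>length ys = length ys'\<close> by simp
  qed
  with eval_Comp.IH(2) ys'(2) show ?case by blast
next
  case (eval_PrimRec_Suc f g n xs r y)
  from eval_PrimRec_Suc.prems obtain r' where
    "eval A (PrimRec f g) (n # xs) r'" "eval A g (n # r' # xs) z"
    by (rule eval_elims)
  with eval_PrimRec_Suc.IH show ?case by blast
next
  case (eval_Mu f n xs)
  from eval_Mu.prems have z: "eval A f (z # xs) 0"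
      "\<And>m. m < z \<Longrightarrow> \<exists>y>0. eval A f (m # xs) y"
    by (rule eval_elims, blast)+
  have "\<not> n < z" using z(2)[of n] eval_Mu.IH(1) by blast
  moreover have "\<not> z < n" using z(1) eval_Mu.IH(2)[of z] by blast
  ultimately show ?case by simp
qed (erule eval_elims; simp)+

definition turing_reducible :: "nat set \<Rightarrow> nat set \<Rightarrow> bool"  (infix "\<le>\<^sub>T" 50) where
  "X \<le>\<^sub>T A \<longleftrightarrow> (\<exists>p. \<forall>n. eval A p [n] (of_bool (n \<in> X)))"

definition string_code :: "bool list \<Rightarrow> nat" where
  "string_code w = list_encode (map of_bool w)"

text \<open>Computability without an oracle is computability with the empty oracle.\<close>

definition uniformly_ce :: "(nat \<Rightarrow> bool list set) \<Rightarrow> bool" where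
  "uniformly_ce U \<longleftrightarrow> (\<exists>p. \<forall>n w. w \<in> U n \<longleftrightarrow> (\<exists>y. eval {} p [n, string_code w] y))"

definition cylinder :: "bool list \<Rightarrow> nat set set" where
  "cylinder w = {X. \<forall>i<length w. w ! i \<longleftrightarrow> i \<in> X}"

definition open_of :: "bool list set \<Rightarrow> nat set set" where
  "open_of V = (\<Union>w\<in>V. cylinder w)"

text \<open>
  Summability is required explicitly because \<^const>\<open>infsum\<close> is 0 for divergent real sums.
\<close>

definition ml_test :: "(nat \<Rightarrow> bool list set) \<Rightarrow> bool" where
  "ml_test U \<longleftrightarrow> uniformly_ce U \<and>
    (\<forall>n. (\<lambda>w. (1/2 :: real) ^ length w) summable_on U n \<and>
         (\<Sum>\<^sub>\<infinity>w\<in>U n. (1/2 :: real) ^ length w) \<le> (1/2) ^ n)"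

definition ml_random :: "nat set \<Rightarrow> bool" where
  "ml_random X \<longleftrightarrow> (\<forall>U. ml_test U \<longrightarrow> X \<notin> (\<Inter>n. open_of (U n)))"

end

theory Submission
  imports Defs
begin

text \<open>
  The set \<open>Y\<close> is an infinite branch of the tree of finite sequences, built by forcing with bushy
  trees. A condition is a node \<open>x\<close> with a set \<open>B\<close> of forbidden nodes that is not \<open>k\<close>-big above \<open>x\<close>.
  The initial forbidden set consists of the nodes whose path has no superset outside a fixed open
  set of measure at most 1/8 that covers all non-random sets. It is not 3-big above the root, because
  a random set contains a path to a leaf of any given 3-branching tree with probability at least 1/4;
  by compactness a branch avoiding it has a random superset.

  To ensure that a program \<open>p\<close> with oracle \<open>Y\<close> computes no random set, consider the nodes which
  already determine the first \<open>i\<close> bits of the output. If they are not \<open>k * 2 ^ i\<close>-big above \<open>x\<close>, they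
  can be forbidden, which makes the output partial. Otherwise some string of length \<open>i\<close> is the output
  on a \<open>k\<close>-big set of nodes, and \<open>x\<close> can be extended to one of them. The first such string to be found
  by a search depends computably on \<open>k\<close>, \<open>x\<close> and \<open>i\<close>, so these strings form a Martin-Loef test, with \<open>i\<close>
  chosen large enough to sum over all \<open>k\<close> and \<open>x\<close>.
\<close>

section \<open>Total computable functions\<close>

named_theorems computable_intros

text \<open>Keeping an arity and a value function instead of a program lets computability of
  compound expressions follow from closure rules, without exhibiting programs.\<close>

definition computable :: "nat \<Rightarrow> (nat list \<Rightarrow> nat) \<Rightarrow> bool" where
  "computable m f \<longleftrightarrow> (\<exists>P. \<forall>xs. length xs = m \<longrightarrow> eval {} P xs (f xs))"

lemma computable_cong:
  assumes "computable m f" "\<And>xs. length xs = m \<Longrightarrow> f xs = g xs"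
  shows "computable m g"
  using assms unfolding computable_def by metis

lemma computable_Comp:
  assumes h: "computable (length gs) h" and gs: "\<And>g. g \<in> set gs \<Longrightarrow> computable m g"
  shows "computable m (\<lambda>xs. h (map (\<lambda>g. g xs) gs))"
proof -
  obtain P where P: "\<And>ys. length ys = length gs \<Longrightarrow> eval {} P ys (h ys)"
    using h unfolding computable_def by blast
  obtain Q where Q: "\<And>g xs. g \<in> set gs \<Longrightarrow> length xs = m \<Longrightarrow> eval {} (Q g) xs (g xs)"
    using gs unfolding computable_def by metis
  have "eval {} (Comp P (map Q gs)) xs (h (map (\<lambda>g. g xs) gs))" if "length xs = m" for xs
    by (rule eval_Comp[OF _ P]) (auto simp: list_all2_conv_all_nth that intro: Q)
  then show ?thesis unfolding computable_def by blast
qed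

lemma computable_nth [computable_intros]: "i < m \<Longrightarrow> computable m (\<lambda>xs. xs ! i)"
  unfolding computable_def by (metis eval_Proj)

lemma computable_comp1:
  assumes "computable 1 (\<lambda>ys. f (ys ! 0))" "computable m a"
  shows "computable m (\<lambda>xs. f (a xs))"
  using computable_Comp[of "[a]" "\<lambda>ys. f (ys ! 0)" m] assms by simp

lemma computable_comp2:
  assumes "computable 2 (\<lambda>ys. f (ys ! 0) (ys ! 1))" "computable m a" "computable m b"
  shows "computable m (\<lambda>xs. f (a xs) (b xs))"
  using computable_Comp[of "[a, b]" "\<lambda>ys. f (ys ! 0) (ys ! 1)" m] assms
  by (auto simp: numeral_2_eq_2)

text \<open>Composition with projections: leading arguments are replaced by computed ones while the
  remaining parameters are passed on. This plumbing recurs in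
  \<open>computable_bounded_eval\<close>.\<close>

lemma computable_append_drop:
  assumes F: "computable (length gs + k) F" and gs: "\<And>g. g \<in> set gs \<Longrightarrow> computable (j + k) g"
  shows "computable (j + k) (\<lambda>xs. F (map (\<lambda>g. g xs) gs @ drop j xs))"
proof (rule computable_cong)
  let ?hs = "gs @ map (\<lambda>i xs. xs ! (j + i)) [0..<k]"
  show "computable (j + k) (\<lambda>xs. F (map (\<lambda>g. g xs) ?hs))"
    by (rule computable_Comp) (auto simp: F gs intro: computable_nth)
  fix xs :: "nat list" assume "length xs = j + k"
  then have "map (\<lambda>i. xs ! (j + i)) [0..<k] = drop j xs"
    by (intro nth_equalityI) auto
  then show "F (map (\<lambda>g. g xs) ?hs) = F (map (\<lambda>g. g xs) gs @ drop j xs)"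
    by (simp add: comp_def)
qed

lemma computable_tl: "computable m f \<Longrightarrow> computable (Suc m) (\<lambda>xs. f (tl xs))"
  using computable_append_drop[of "[]" m f 1] by (simp add: drop_Suc)

lemma computable_tl_tl:
  "computable m f \<Longrightarrow> computable (Suc (Suc m)) (\<lambda>xs. f (tl (tl xs)))"
  using computable_tl[OF computable_tl] .

lemma computable_Suc [computable_intros]:
  assumes "computable m f" shows "computable m (\<lambda>xs. Suc (f xs))"
proof (rule computable_comp1[where f = Suc, OF _ assms])
  have "eval {} Succ xs (Suc (xs ! 0))" if "length xs = 1" for xs
    using that by (cases xs) (auto intro: eval_Succ)
  then show "computable 1 (\<lambda>ys. Suc (ys ! 0))" unfolding computable_def by blast
qed

lemma computable_const [computable_intros]: "computable m (\<lambda>_. c)"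
proof (induction c)
  case 0
  show ?case unfolding computable_def using eval_Zero by blast
next
  case (Suc c)
  then show ?case by (rule computable_Suc)
qed

text \<open>\<open>PrimRec\<close> supplies the counter and the previous result in front of the
  parameters, hence the shape of the hypothesis on \<open>g\<close>; the count \<open>N\<close>
  enters afterwards by composition.\<close>

lemma computable_rec:
  assumes b: "computable m b" and g: "computable (Suc (Suc m)) (\<lambda>ys. g (ys ! 0) (ys ! 1) (tl (tl ys)))"
    and N: "computable m N"
  shows "computable m (\<lambda>xs. rec_nat (b xs) (\<lambda>n r. g n r xs) (N xs))"
proof -
  obtain P where P: "\<And>xs. length xs = m \<Longrightarrow> eval {} P xs (b xs)"
    using b unfolding computable_def by blast
  obtain Q where Q: "\<And>ys. length ys = Suc (Suc m) \<Longrightarrow>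
      eval {} Q ys (g (ys ! 0) (ys ! 1) (tl (tl ys)))"
    using g unfolding computable_def by blast
  let ?f = "\<lambda>ys. rec_nat (b (tl ys)) (\<lambda>n r. g n r (tl ys)) (ys ! 0)"
  have *: "eval {} (PrimRec P Q) (n # xs) (rec_nat (b xs) (\<lambda>n r. g n r xs) n)"
    if "length xs = m" for n xs
  proof (induction n)
    case 0
    show ?case by (auto intro!: eval_PrimRec_0 P that)
  next
    case (Suc n)
    then show ?case
      using Q[of "n # rec_nat (b xs) (\<lambda>n r. g n r xs) n # xs"] that
      by (auto intro!: eval_PrimRec_Suc[OF Suc])
  qed
  have "computable (Suc m) ?f"
    unfolding computable_def
  proof (intro exI allI impI)
    fix ys :: "nat list" assume "length ys = Suc m"
    then show "eval {} (PrimRec P Q) ys (?f ys)" using *[of "tl ys" "hd ys"] by (cases ys) auto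
  qed
  then have "computable m (\<lambda>xs. ?f (map (\<lambda>g. g xs) (N # map (\<lambda>i xs. xs ! i) [0..<m])))"
    by (intro computable_Comp) (auto simp: N intro: computable_nth)
  then show ?thesis
    by (rule computable_cong) (auto simp: comp_def map_nth)
qed

section \<open>Arithmetic operations and bounded sums\<close>

lemma computable_add [computable_intros]:
  assumes "computable m a" "computable m b" shows "computable m (\<lambda>xs. a xs + b xs)"
proof (rule computable_cong)
  show "computable m (\<lambda>xs. rec_nat (a xs) (\<lambda>n r. Suc r) (b xs))"
    by (intro computable_rec computable_intros assms) simp
  have "rec_nat x (\<lambda>n r. Suc r) y = x + y" for x y by (induction y) auto
  then show "rec_nat (a xs) (\<lambda>n r. Suc r) (b xs) = a xs + b xs" for xs by simp
qed

lemma computable_mult [computable_intros]: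
  assumes "computable m a" "computable m b" shows "computable m (\<lambda>xs. a xs * b xs)"
proof (rule computable_cong)
  show "computable m (\<lambda>xs. rec_nat 0 (\<lambda>n r. r + a xs) (b xs))"
    by (intro computable_rec computable_intros assms computable_tl_tl[OF assms(1)]) simp
  have "rec_nat 0 (\<lambda>n r. r + x) y = x * y" for x y :: nat by (induction y) auto
  then show "rec_nat 0 (\<lambda>n r. r + a xs) (b xs) = a xs * b xs" for xs by simp
qed

lemma computable_diff [computable_intros]:
  assumes "computable m a" "computable m b" shows "computable m (\<lambda>xs. a xs - b xs)"
proof (rule computable_cong)
  \<comment> \<open>Predecessor: the recursion ignores the previous result and returns its
    counter.\<close>
  have "computable k (\<lambda>xs. c xs - 1)" if "computable k c" for k c
  proof (rule computable_cong)
    show "computable k (\<lambda>xs. rec_nat 0 (\<lambda>n r. n) (c xs))"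
      by (intro computable_rec computable_intros that) simp
    have "rec_nat 0 (\<lambda>n r. n) y = y - 1" for y by (cases y) auto
    then show "rec_nat 0 (\<lambda>n r. n) (c xs) = c xs - 1" for xs by simp
  qed
  then have "computable (Suc (Suc m)) (\<lambda>xs. xs ! 1 - 1)"
    by (simp add: computable_nth)
  then show "computable m (\<lambda>xs. rec_nat (a xs) (\<lambda>n r. r - 1) (b xs))"
    by (rule computable_rec[OF assms(1) _ assms(2)])
  have "rec_nat x (\<lambda>n r. r - 1) y = x - y" for x y :: nat by (induction y) auto
  then show "rec_nat (a xs) (\<lambda>n r. r - 1) (b xs) = a xs - b xs" for xs by simp
qed

text \<open>Bounded sums serve below for bounded quantifiers, for decoding pairs and for bounded
  search.\<close>

lemma computable_sum [computable_intros]: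
  assumes "computable (Suc m) (\<lambda>ys. f (ys ! 0) (tl ys))" "computable m N"
  shows "computable m (\<lambda>xs. \<Sum>n<N xs. f n xs)"
proof (rule computable_cong)
  have "computable (Suc (Suc m)) (\<lambda>ys. f (ys ! 0) (tl (tl ys)))"
    using computable_append_drop[of "[\<lambda>ys. ys ! 0]" m "\<lambda>ys. f (ys ! 0) (tl ys)" 2]
    by (auto simp: assms(1) numeral_2_eq_2 drop_Suc intro: computable_nth)
  then have "computable (Suc (Suc m)) (\<lambda>ys. ys ! 1 + f (ys ! 0) (tl (tl ys)))"
    by (intro computable_add computable_nth) simp_all
  then show "computable m (\<lambda>xs. rec_nat 0 (\<lambda>n r. r + f n xs) (N xs))"
    by (rule computable_rec[OF computable_const _ assms(2)])
  have "rec_nat 0 (\<lambda>n r. r + f n xs) y = (\<Sum>n<y. f n xs)" for y xs by (induction y) auto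
  then show "rec_nat 0 (\<lambda>n r. r + f n xs) (N xs) = (\<Sum>n<N xs. f n xs)" for xs by simp
qed

section \<open>Decidable predicates and bounded quantifiers\<close>

abbreviation decidable :: "nat \<Rightarrow> (nat list \<Rightarrow> bool) \<Rightarrow> bool" where
  "decidable m P \<equiv> computable m (\<lambda>xs. of_bool (P xs))"

lemma decidable_not [computable_intros]:
  assumes "decidable m P" shows "decidable m (\<lambda>xs. \<not> P xs)"
proof (rule computable_cong)
  show "computable m (\<lambda>xs. 1 - of_bool (P xs))" by (intro computable_intros assms)
qed simp

lemma decidable_conj [computable_intros]:
  assumes "decidable m P" "decidable m Q" shows "decidable m (\<lambda>xs. P xs \<and> Q xs)"
proof (rule computable_cong)
  show "computable m (\<lambda>xs. of_bool (P xs) * of_bool (Q xs))" by (intro computable_intros assms)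
qed simp

lemma decidable_disj [computable_intros]:
  assumes "decidable m P" "decidable m Q" shows "decidable m (\<lambda>xs. P xs \<or> Q xs)"
  using decidable_not[OF decidable_conj[OF decidable_not decidable_not], OF assms] by simp

lemma decidable_imp [computable_intros]:
  assumes "decidable m P" "decidable m Q" shows "decidable m (\<lambda>xs. P xs \<longrightarrow> Q xs)"
  using decidable_disj[OF decidable_not, OF assms] by (simp only: imp_conv_disj)

lemma decidable_le [computable_intros]:
  assumes "computable m a" "computable m b" shows "decidable m (\<lambda>xs. a xs \<le> b xs)"
proof (rule computable_cong)
  show "computable m (\<lambda>xs. 1 - (a xs - b xs))" by (intro computable_intros assms)
qed simp

lemma decidable_less [computable_intros]:
  assumes "computable m a" "computable m b" shows "decidable m (\<lambda>xs. a xs < b xs)"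
  using decidable_le[OF computable_Suc, OF assms] by (simp only: Suc_le_eq)

lemma decidable_eq [computable_intros]:
  assumes "computable m a" "computable m b" shows "decidable m (\<lambda>xs. a xs = b xs)"
  using decidable_conj[OF decidable_le[OF assms] decidable_le[OF assms(2,1)]]
  by (simp only: order_eq_iff)

lemma computable_if [computable_intros]:
  assumes "decidable m P" "computable m f" "computable m g"
  shows "computable m (\<lambda>xs. if P xs then f xs else g xs)"
proof (rule computable_cong)
  show "computable m (\<lambda>xs. of_bool (P xs) * f xs + (1 - of_bool (P xs)) * g xs)"
    by (intro computable_intros assms)
qed simp

lemma decidable_all [computable_intros]:
  assumes "decidable (Suc m) (\<lambda>ys. P (ys ! 0) (tl ys))" "computable m N"
  shows "decidable m (\<lambda>xs. \<forall>n<N xs. P n xs)"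
proof (rule computable_cong)
  \<comment> \<open>The number of counterexamples is compared with zero.\<close>
  show "decidable m (\<lambda>xs. (\<Sum>n<N xs. of_bool (\<not> P n xs)) = (0::nat))"
    by (intro computable_intros assms)
qed auto

lemma decidable_ex [computable_intros]:
  assumes "decidable (Suc m) (\<lambda>ys. P (ys ! 0) (tl ys))" "computable m N"
  shows "decidable m (\<lambda>xs. \<exists>n<N xs. P n xs)"
  using decidable_not[OF decidable_all[OF decidable_not, OF assms]] by simp

lemma computable_funpow:
  assumes "computable 1 (\<lambda>ys. f (ys ! 0))" "computable m a" "computable m N"
  shows "computable m (\<lambda>xs. (f ^^ N xs) (a xs))"
proof (rule computable_cong)
  show "computable m (\<lambda>xs. rec_nat (a xs) (\<lambda>n r. f r) (N xs))"
    by (intro computable_rec computable_comp1[OF assms(1)] computable_intros assms) simp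
  have "rec_nat x (\<lambda>n r. f r) y = (f ^^ y) x" for x y by (induction y) auto
  then show "rec_nat (a xs) (\<lambda>n r. f r) (N xs) = (f ^^ N xs) (a xs)" for xs by simp
qed

lemma computable_tl_nth [computable_intros]: "Suc i < m \<Longrightarrow> computable m (\<lambda>xs. tl xs ! i)"
  using computable_tl[OF computable_nth, of i "m - 1"] by (cases m) auto

lemma computable_tl_tl_nth [computable_intros]:
  "Suc (Suc i) < m \<Longrightarrow> computable m (\<lambda>xs. tl (tl xs) ! i)"
  using computable_tl[OF computable_tl_nth, of i "m - 1"] by (cases m) auto

section \<open>Coding of pairs\<close>

lemma computable_prod_encode [computable_intros]:
  assumes "computable m a" "computable m b"
  shows "computable m (\<lambda>xs. prod_encode (a xs, b xs))"
proof (rule computable_cong)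
  show "computable m (\<lambda>xs. (\<Sum>i<Suc (a xs + b xs). i) + a xs)"
    by (intro computable_intros assms) simp
  have "(\<Sum>i<Suc n. i) = triangle n" for n by (induction n) auto
  then show "(\<Sum>i<Suc (a xs + b xs). i) + a xs = prod_encode (a xs, b xs)" for xs
    by (simp add: prod_encode_def)
qed

lemma computable_fst_prod_decode [computable_intros]:
  assumes "computable m f" shows "computable m (\<lambda>xs. fst (prod_decode (f xs)))"
proof (rule computable_comp1[OF _ assms, where f = "\<lambda>z. fst (prod_decode z)"])
  \<comment> \<open>Both components are at most the code, so a search up to \<open>z\<close> meets
    the pair, and only its summand can be nonzero.\<close>
  have *: "fst (prod_decode z) =
      (\<Sum>a<Suc z. \<Sum>b<Suc z. if prod_encode (a, b) = z then a else 0)" for z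
  proof -
    obtain a b where ab: "prod_decode z = (a, b)" by fastforce
    then have z: "prod_encode (a, b) = z" by (metis prod_decode_inverse)
    then have le: "a < Suc z" "b < Suc z"
      using le_prod_encode_1[of a b] le_prod_encode_2[of b a] by simp_all
    have "(\<Sum>b'<Suc z. if prod_encode (a', b') = z then a' else 0) = (if a' = a then a else 0)" for a'
    proof -
      have "(\<Sum>b'<Suc z. if prod_encode (a', b') = z then a' else 0) =
          (\<Sum>b'<Suc z. if b = b' then if a' = a then a else 0 else 0)"
        using z by (intro sum.cong) auto
      with le show ?thesis by (simp only: sum.delta' finite_lessThan lessThan_iff if_True)
    qed
    with le show ?thesis unfolding ab by (simp only: sum.delta finite_lessThan lessThan_iff if_True fst_conv)
  qed
  show "computable 1 (\<lambda>ys. fst (prod_decode (ys ! 0)))"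
    unfolding * by (intro computable_intros) simp_all
qed

lemma computable_snd_prod_decode [computable_intros]:
  assumes "computable m f" shows "computable m (\<lambda>xs. snd (prod_decode (f xs)))"
proof (rule computable_comp1[OF _ assms, where f = "\<lambda>z. snd (prod_decode z)"])
  \<comment> \<open>With the first component already computable, a single bounded search for the
    second remains.\<close>
  have *: "snd (prod_decode z) =
      (\<Sum>b<Suc z. if prod_encode (fst (prod_decode z), b) = z then b else 0)" for z
  proof -
    obtain a b where ab: "prod_decode z = (a, b)" by fastforce
    then have z: "prod_encode (a, b) = z" by (metis prod_decode_inverse)
    then have le: "b < Suc z"
      using le_prod_encode_2[of b a] by simp_all
    have "(\<Sum>b'<Suc z. if prod_encode (a, b') = z then b' else 0) =
        (\<Sum>b'<Suc z. if b = b' then b' else 0)"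
      using z by (intro sum.cong) auto
    with le show ?thesis unfolding ab by (simp only: sum.delta' finite_lessThan lessThan_iff if_True fst_conv snd_conv)
  qed
  show "computable 1 (\<lambda>ys. snd (prod_decode (ys ! 0)))"
    by (subst *) (intro computable_intros; simp)
qed

text \<open>\<open>Mu\<close> searches for a zero of the characteristic function of the complement
  of \<open>M\<close>; that function is total, so the search halts exactly when a witness
  exists.\<close>

lemma semidecidable_ex:
  assumes "decidable 3 (\<lambda>xs. M (xs ! 0) (xs ! 1) (xs ! 2))"
  shows "\<exists>P. \<forall>n c. (\<exists>z. M z n c) \<longleftrightarrow> (\<exists>y. eval {} P [n, c] y)"
proof -
  obtain P where P: "\<And>xs. length xs = 3 \<Longrightarrow> eval {} P xs (of_bool (\<not> M (xs ! 0) (xs ! 1) (xs ! 2)))"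
    using decidable_not[OF assms] unfolding computable_def by blast
  have "(\<exists>z. M z n c) \<longleftrightarrow> (\<exists>y. eval {} (Mu P) [n, c] y)" for n c
  proof
    assume "\<exists>z. M z n c"
    then have "M (LEAST z. M z n c) n c" by (rule LeastI_ex)
    moreover have "\<not> M z n c" if "z < (LEAST z. M z n c)" for z
      using not_less_Least[OF that] .
    moreover have "eval {} P [z, n, c] (of_bool (\<not> M z n c))" for z
      using P[of "[z, n, c]"] by (simp add: numeral_2_eq_2 numeral_3_eq_3)
    ultimately have "eval {} (Mu P) [n, c] (LEAST z. M z n c)"
      by (intro eval_Mu) (metis of_bool_eq(1), metis of_bool_eq(2) zero_less_one)
    then show "\<exists>y. eval {} (Mu P) [n, c] y" ..
  next
    assume "\<exists>y. eval {} (Mu P) [n, c] y"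
    then obtain y where "eval {} (Mu P) [n, c] y" ..
    then have "eval {} P [y, n, c] 0" by (rule eval_elims)
    moreover have "eval {} P [y, n, c] (of_bool (\<not> M y n c))"
      using P[of "[y, n, c]"] by (simp add: numeral_2_eq_2 numeral_3_eq_3)
    ultimately have "of_bool (\<not> M y n c) = (0::nat)"
      using eval_deterministic by blast
    then show "\<exists>z. M z n c" by auto
  qed
  then show ?thesis by blast
qed

section \<open>Bushy trees\<close>

text \<open>
  Nodes of the tree of finite sequences, as numbers: \<open>list_encode (c # s)\<close> is a child of
  \<open>list_encode s\<close>, and 0 is the root. Numbers increase along branches, so a node \<open>x\<close> of a branch
  decides which numbers up to \<open>x\<close> belong to the branch.
\<close>

definition parent :: "nat \<Rightarrow> nat" where
  "parent x = (if x = 0 then 0 else snd (prod_decode (x - 1)))"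

definition children :: "nat \<Rightarrow> nat set" where
  "children x = {c. c \<noteq> 0 \<and> parent c = x}"

definition ancestors :: "nat \<Rightarrow> nat set" where
  "ancestors x = {y. \<exists>n. (parent ^^ n) x = y}"

lemma parent_0 [simp]: "parent 0 = 0"
  by (simp add: parent_def)

lemma parent_less: "x \<noteq> 0 \<Longrightarrow> parent x < x"
  unfolding parent_def using le_prod_encode_2[of "snd (prod_decode (x - 1))" "fst (prod_decode (x - 1))"]
  by simp

lemma children_greater: "c \<in> children x \<Longrightarrow> x < c"
  unfolding children_def using parent_less by auto

lemma infinite_children: "infinite (children x)"
proof
  assume "finite (children x)"
  moreover have "range (\<lambda>a. Suc (prod_encode (a, x))) \<subseteq> children x"
    by (auto simp: children_def parent_def)
  ultimately have "finite (range (\<lambda>a. Suc (prod_encode (a, x))))" by (rule rev_finite_subset)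
  moreover have "inj (\<lambda>a. Suc (prod_encode (a, x)))" by (rule injI) simp
  ultimately show False by (simp add: range_inj_infinite)
qed

lemma ancestors_refl [simp]: "x \<in> ancestors x"
  by (auto simp: ancestors_def intro: exI[of _ 0])

lemma ancestors_0 [simp]: "ancestors 0 = {0}"
proof -
  have "(parent ^^ n) 0 = 0" for n by (induction n) auto
  then show ?thesis by (auto simp: ancestors_def)
qed

lemma ancestors_parent: "ancestors x = insert x (ancestors (parent x))"
proof -
  have "y \<in> ancestors x \<longleftrightarrow> y = x \<or> y \<in> ancestors (parent x)" for y
  proof -
    have "y \<in> ancestors x \<longleftrightarrow> (\<exists>n. (parent ^^ n) x = y)" by (simp add: ancestors_def)
    also have "\<dots> \<longleftrightarrow> y = x \<or> (\<exists>n. (parent ^^ Suc n) x = y)"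
    proof
      assume "\<exists>n. (parent ^^ n) x = y"
      then obtain n where "(parent ^^ n) x = y" ..
      then show "y = x \<or> (\<exists>n. (parent ^^ Suc n) x = y)" by (cases n) auto
    next
      assume "y = x \<or> (\<exists>n. (parent ^^ Suc n) x = y)"
      then show "\<exists>n. (parent ^^ n) x = y"
      proof
        assume "y = x"
        then have "(parent ^^ 0) x = y" by simp
        then show ?thesis ..
      qed blast
    qed
    finally show ?thesis by (simp only: ancestors_def mem_Collect_eq funpow_Suc_right comp_apply)
  qed
  then show ?thesis by blast
qed

lemma ancestors_children: "c \<in> children x \<Longrightarrow> ancestors c = insert c (ancestors x)"
  using ancestors_parent[of c] by (simp add: children_def)

lemma ancestors_le: "y \<in> ancestors x \<Longrightarrow> y \<le> x"
proof (induction x rule: less_induct)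
  case (less x)
  show ?case
  proof (cases "x = 0")
    case False
    then have "y = x \<or> y \<in> ancestors (parent x)" using less.prems ancestors_parent by blast
    then show ?thesis using less.IH[OF parent_less[OF False]] parent_less[OF False] by linarith
  qed (use less.prems in simp)
qed

lemma ancestors_trans: "x \<in> ancestors y \<Longrightarrow> y \<in> ancestors z \<Longrightarrow> x \<in> ancestors z"
  unfolding ancestors_def mem_Collect_eq
proof (elim exE)
  fix m n assume "(parent ^^ m) y = x" "(parent ^^ n) z = y"
  then have "(parent ^^ (m + n)) z = x" by (simp add: funpow_add)
  then show "\<exists>n. (parent ^^ n) z = x" ..
qed

lemma zero_in_ancestors [simp]: "0 \<in> ancestors x"
proof (induction x rule: less_induct)
  case (less x)
  show ?case
  proof (cases "x = 0")
    case False
    then have "0 \<in> ancestors (parent x)" using less.IH parent_less by simp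
    then show ?thesis by (subst ancestors_parent) simp
  qed simp
qed

text \<open>The ancestors of a node form a chain on which the numerical order is the tree order.
  Hence the cones above distinct siblings are disjoint, and a node of a branch determines the branch
  below it.\<close>

lemma ancestors_linear:
  "y \<in> ancestors x \<Longrightarrow> z \<in> ancestors x \<Longrightarrow> z \<le> y \<Longrightarrow> z \<in> ancestors y"
proof (induction x rule: less_induct)
  case (less x)
  show ?case
  proof (cases "x = 0 \<or> y = x")
    case False
    then have x: "parent x < x" using parent_less by blast
    have y: "y \<in> ancestors (parent x)" using False less.prems(1) ancestors_parent by blast
    then have "z \<noteq> x" using ancestors_le[OF y] x less.prems(3) by linarith
    then have "z \<in> ancestors (parent x)" using less.prems(2) ancestors_parent by blast
    with less.IH[OF x y] less.prems show ?thesis by blast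
  next
    case True
    then show ?thesis using less.prems by (cases "x = 0") simp_all
  qed
qed

text \<open>
  Bushy largeness: a finite tree above \<open>x\<close> has all its leaves in \<open>A\<close> and at least \<open>k\<close> children at
  every inner node.
\<close>

inductive big :: "nat \<Rightarrow> nat set \<Rightarrow> nat \<Rightarrow> bool" for k A where
  leaf: "x \<in> A \<Longrightarrow> big k A x"
| node: "finite C \<Longrightarrow> k \<le> card C \<Longrightarrow> C \<subseteq> children x \<Longrightarrow> (\<And>c. c \<in> C \<Longrightarrow> big k A c) \<Longrightarrow> big k A x"

text \<open>Pigeonhole at every inner node: each child is big for one of the two sets, so among
  \<open>k + l\<close> children either \<open>k\<close> are big for \<open>A\<close> or
  \<open>l\<close> are big for \<open>B\<close>.\<close>

lemma big_Un: "big (k + l) (A \<union> B) x \<Longrightarrow> big k A x \<or> big l B x"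
proof (induction rule: big.induct)
  case (leaf x)
  then show ?case by (auto intro: big.leaf)
next
  case (node C x)
  let ?C1 = "{c \<in> C. big k A c}" and ?C2 = "{c \<in> C. big l B c}"
  have "card C \<le> card ?C1 + card ?C2"
  proof -
    have "C = ?C1 \<union> ?C2" using node.IH by blast
    then show ?thesis using card_Un_le[of ?C1 ?C2] by simp
  qed
  then have "k \<le> card ?C1 \<or> l \<le> card ?C2" using node.hyps by linarith
  moreover have "big k A x" if "k \<le> card ?C1"
    by (rule big.node[OF _ that]) (use node.hyps in auto)
  moreover have "big l B x" if "l \<le> card ?C2"
    by (rule big.node[OF _ that]) (use node.hyps in auto)
  ultimately show ?case by blast
qed

lemma big_UN:
  assumes "finite I" "I \<noteq> {}" "big (k * card I) (\<Union>i\<in>I. A i) x"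
  shows "\<exists>i\<in>I. big k (A i) x"
  using assms
proof (induction I rule: finite_ne_induct)
  case (insert i I)
  then have "big (k + k * card I) (A i \<union> (\<Union>i\<in>I. A i)) x" by simp
  from big_Un[OF this] insert.IH show ?case by blast
qed simp

text \<open>Trees for \<open>B\<close> are grafted onto the leaves in \<open>A\<close>. Used
  contrapositively, it finds a node of a big set above which \<open>B\<close> is still
  small.\<close>

lemma big_subst:
  assumes "big k A x" "\<And>y. y \<in> A \<Longrightarrow> x \<in> ancestors y \<Longrightarrow> big k B y"
  shows "big k B x"
  using assms
proof (induction rule: big.induct)
  case (node C x)
  have "big k B c" if "c \<in> C" for c
  proof (rule node.IH[OF that])
    fix y assume "y \<in> A" "c \<in> ancestors y"
    moreover have "x \<in> ancestors c" using ancestors_children[of c x] node.hyps that by auto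
    ultimately show "big k B y" using node.prems ancestors_trans by blast
  qed
  then show ?case by (rule big.node[OF node.hyps(1-3)])
next
  case (leaf x)
  show ?case by (rule leaf.prems[OF leaf.hyps ancestors_refl])
qed

text \<open>Otherwise any \<open>k\<close> of the infinitely many children would make
  \<open>B\<close> big above \<open>x\<close>.\<close>

lemma not_big_child:
  assumes "\<not> big k B x" shows "\<exists>c\<in>children x. \<not> big k B c"
proof -
  obtain C where "C \<subseteq> children x" "finite C" "card C = k"
    using infinite_arbitrarily_large[OF infinite_children] by blast
  with assms big.node[of C k x B] show ?thesis by blast
qed

text \<open>The tree is stored as a bare set of nodes, so that a finite one can be coded by a number
  and checked with bounded quantifiers.\<close>

definition big_witness :: "nat \<Rightarrow> nat set \<Rightarrow> nat \<Rightarrow> nat set \<Rightarrow> bool" where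
  "big_witness k A x F \<longleftrightarrow> x \<in> F \<and> (\<forall>y\<in>F. y \<in> A \<or> k \<le> card (F \<inter> children y))"

lemma big_iff_witness: "big k A x \<longleftrightarrow> (\<exists>F. finite F \<and> big_witness k A x F)"
proof
  assume "big k A x"
  then show "\<exists>F. finite F \<and> big_witness k A x F"
  proof (induction rule: big.induct)
    case (leaf x)
    then show ?case by (intro exI[of _ "{x}"]) (auto simp: big_witness_def)
  next
    case (node C x)
    then have "\<forall>c\<in>C. \<exists>F. finite F \<and> big_witness k A c F" by blast
    from bchoice[OF this] obtain F
      where F: "\<And>c. c \<in> C \<Longrightarrow> finite (F c) \<and> big_witness k A c (F c)" by blast
    define G where "G = insert x (\<Union>c\<in>C. F c)"
    have fin: "finite G" using F node.hyps by (auto simp: G_def)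
    have "C \<subseteq> G \<inter> children x" using F node.hyps by (auto simp: G_def big_witness_def)
    then have "k \<le> card (G \<inter> children x)" using fin node.hyps(2)
      by (meson card_mono finite_Int order_trans)
    moreover have "y \<in> A \<or> k \<le> card (G \<inter> children y)" if "c \<in> C" "y \<in> F c" for c y
    proof -
      have "card (F c \<inter> children y) \<le> card (G \<inter> children y)"
        using fin that by (intro card_mono) (auto simp: G_def)
      moreover have "y \<in> A \<or> k \<le> card (F c \<inter> children y)"
        using F[OF that(1)] that(2) unfolding big_witness_def by blast
      ultimately show ?thesis by linarith
    qed
    ultimately have "\<forall>y\<in>G. y \<in> A \<or> k \<le> card (G \<inter> children y)"
      unfolding G_def by blast
    moreover have "x \<in> G" by (simp add: G_def)
    ultimately show ?case using fin unfolding big_witness_def by blast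
  qed
next
  assume "\<exists>F. finite F \<and> big_witness k A x F"
  then obtain F where F: "finite F" "big_witness k A x F" by blast
  have "y \<in> F \<Longrightarrow> big k A y" for y
  \<comment> \<open>Children have larger numbers, so the distance to \<open>Max F\<close> shrinks on
    the way up the tree.\<close>
  proof (induction "Max F - y" arbitrary: y rule: less_induct)
    case less
    show ?case
    proof (cases "y \<in> A")
      case False
      show ?thesis
      proof (rule big.node[of "F \<inter> children y"])
        fix c assume c: "c \<in> F \<inter> children y"
        then have "y < c" "c \<le> Max F" using children_greater F(1) by auto
        then have "Max F - c < Max F - y" by linarith
        then show "big k A c" using less.hyps c by blast
      next
        show "k \<le> card (F \<inter> children y)" using F False less.prems unfolding big_witness_def by blast
      qed (use F in simp_all)
    qed (rule big.leaf)
  qed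
  with F show "big k A x" by (simp add: big_witness_def)
qed

section \<open>Evaluation along a branch\<close>

lemma computable_parent [computable_intros]:
  "computable m f \<Longrightarrow> computable m (\<lambda>xs. parent (f xs))"
  unfolding parent_def by (intro computable_intros)

lemma computable_parent_funpow [computable_intros]:
  assumes "computable m f" "computable m N" shows "computable m (\<lambda>xs. (parent ^^ N xs) (f xs))"
  by (rule computable_funpow) (intro computable_intros assms; simp)+

lemma funpow_parent_le: "(parent ^^ n) x \<le> x - n"
proof (induction n)
  case (Suc n)
  then show ?case using parent_less[of "(parent ^^ n) x"] by (cases "(parent ^^ n) x = 0") auto
qed simp

lemma decidable_ancestors [computable_intros]:
  assumes "computable m a" "computable m b"
  shows "decidable m (\<lambda>xs. a xs \<in> ancestors (b xs))"
proof -
  \<comment> \<open>Each step from a nonzero node decreases it, so \<open>0\<close> is reached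
    within \<open>x\<close> steps and a bounded search suffices.\<close>
  have *: "y \<in> ancestors x \<longleftrightarrow> (\<exists>n<Suc x. (parent ^^ n) x = y)" for x y
  proof
    assume "y \<in> ancestors x"
    then obtain n where n: "(parent ^^ n) x = y" by (auto simp: ancestors_def)
    show "\<exists>n<Suc x. (parent ^^ n) x = y"
    proof (cases "n < Suc x")
      case False
      then have "(parent ^^ x) x = y" using n funpow_parent_le[of n x] funpow_parent_le[of x x] by simp
      then show ?thesis by blast
    qed (use n in blast)
  qed (auto simp: ancestors_def)
  have "decidable 2 (\<lambda>ys. ys ! 0 \<in> ancestors (ys ! 1))"
    unfolding * by (intro computable_intros) simp_all
  from computable_comp2[of "\<lambda>y x. of_bool (y \<in> ancestors x)", OF this assms]
  show ?thesis .
qed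

section \<open>Computing with coded lists\<close>

lemma funpow_parent_list_decode: "(parent ^^ n) x = list_encode (drop n (list_decode x))"
proof (induction n)
  case (Suc n)
  have "parent (list_encode ys) = list_encode (tl ys)" for ys
    by (cases ys) (simp_all add: parent_def)
  with Suc show ?case by (simp add: tl_drop drop_Suc)
qed simp

text \<open>An arithmetic form of \<open>list_decode x ! n\<close> for indices in range: iterating
  \<open>parent\<close> drops entries, and the code of a nonempty list is one more than a
  pair.\<close>

definition list_entry :: "nat \<Rightarrow> nat \<Rightarrow> nat" where
  "list_entry x n = fst (prod_decode ((parent ^^ n) x - 1))"

lemma list_entry_eq: "n < length (list_decode x) \<Longrightarrow> list_entry x n = list_decode x ! n"
  unfolding list_entry_def funpow_parent_list_decode
  by (subst Cons_nth_drop_Suc[symmetric]) simp_all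

lemma computable_list_entry [computable_intros]:
  "computable m a \<Longrightarrow> computable m b \<Longrightarrow> computable m (\<lambda>xs. list_entry (a xs) (b xs))"
  unfolding list_entry_def by (intro computable_intros)

lemma length_le_list_encode: "length ys \<le> list_encode ys"
proof (induction ys)
  case (Cons y ys)
  then show ?case using le_prod_encode_2[of "list_encode ys" y] by simp
qed simp

lemma elem_less_list_encode: "y \<in> set ys \<Longrightarrow> y < list_encode ys"
proof (induction ys)
  case (Cons z ys)
  then show ?case
    using le_prod_encode_1[of z "list_encode ys"] le_prod_encode_2[of "list_encode ys" z] by auto
qed simp

lemma elem_less_list_decode: "y \<in> set (list_decode x) \<Longrightarrow> y < x"
  using elem_less_list_encode[of y "list_decode x"] by simp

lemma computable_length [computable_intros]:
  assumes "computable m f" shows "computable m (\<lambda>xs. length (list_decode (f xs)))"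
proof (rule computable_comp1[OF _ assms, where f = "\<lambda>x. length (list_decode x)"])
  \<comment> \<open>Only the empty list has code \<open>0\<close>, so the nonzero iterates of
    \<open>parent\<close> count the entries; the code itself bounds the length.\<close>
  have *: "length (list_decode x) = (\<Sum>n<x. of_bool ((parent ^^ n) x \<noteq> 0))" for x
  proof -
    have "(parent ^^ n) x \<noteq> 0 \<longleftrightarrow> n < length (list_decode x)" for n
      using list_encode_eq[of _ "[]"] by (simp add: funpow_parent_list_decode not_le)
    moreover have "length (list_decode x) \<le> x"
      using length_le_list_encode[of "list_decode x"] by simp
    ultimately have "{n \<in> {..<x}. (parent ^^ n) x \<noteq> 0} = {..<length (list_decode x)}"
      by (simp only: set_eq_iff mem_Collect_eq lessThan_iff) (meson less_le_trans)
    moreover have "(\<Sum>n<x. of_bool ((parent ^^ n) x \<noteq> 0)) = card {n \<in> {..<x}. (parent ^^ n) x \<noteq> 0}"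
      by (simp add: of_bool_def sum.If_cases Int_def)
    ultimately show ?thesis by simp
  qed
  show "computable 1 (\<lambda>ys. length (list_decode (ys ! 0)))"
    unfolding * by (intro computable_intros) simp_all
qed

lemma decidable_in_list [computable_intros]:
  assumes "computable m a" "computable m b"
  shows "decidable m (\<lambda>xs. a xs \<in> set (list_decode (b xs)))"
proof -
  have *: "y \<in> set (list_decode x) \<longleftrightarrow> (\<exists>n<length (list_decode x). list_entry x n = y)" for x y
    by (auto simp: in_set_conv_nth list_entry_eq)
  have "decidable 2 (\<lambda>ys. ys ! 0 \<in> set (list_decode (ys ! 1)))"
    unfolding * by (intro computable_intros) simp_all
  from computable_comp2[of "\<lambda>y x. of_bool (y \<in> set (list_decode x))", OF this assms]
  show ?thesis .
qed

section \<open>Evaluation with bounded searches and bounded oracle use\<close>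

text \<open>
  Searches stop at \<open>b\<close>, and only oracle queries up to \<open>b\<close> are answered. The value 0 means
  divergence, \<open>Suc y\<close> means output \<open>y\<close>.
\<close>

primrec bounded_eval :: "nat set \<Rightarrow> nat \<Rightarrow> prog \<Rightarrow> nat list \<Rightarrow> nat" where
  "bounded_eval A b Zero = (\<lambda>xs. 1)"
| "bounded_eval A b Succ = (\<lambda>xs. if length xs = 1 then Suc (Suc (xs ! 0)) else 0)"
| "bounded_eval A b (Proj i) = (\<lambda>xs. if i < length xs then Suc (xs ! i) else 0)"
| "bounded_eval A b Oracle =
    (\<lambda>xs. if length xs = 1 \<and> xs ! 0 \<le> b then Suc (of_bool (xs ! 0 \<in> A)) else 0)"
| "bounded_eval A b (Comp f gs) =
    (\<lambda>xs. if \<forall>h\<in>set (map (bounded_eval A b) gs). h xs \<noteq> 0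
      then bounded_eval A b f (map (\<lambda>h. h xs - 1) (map (bounded_eval A b) gs)) else 0)"
| "bounded_eval A b (PrimRec f g) =
    (\<lambda>xs. if xs = [] then 0 else rec_nat (bounded_eval A b f (tl xs))
      (\<lambda>n r. if r = 0 then 0 else bounded_eval A b g (n # (r - 1) # tl xs)) (xs ! 0))"
| "bounded_eval A b (Mu f) =
    (\<lambda>xs. \<Sum>n<Suc b. if bounded_eval A b f (n # xs) = 1 \<and> (\<forall>m<n. 1 < bounded_eval A b f (m # xs))
      then Suc n else 0)"

lemma decidable_Ball_list:
  "(\<And>g. g \<in> set gs \<Longrightarrow> decidable m (P g)) \<Longrightarrow> decidable m (\<lambda>xs. \<forall>g\<in>set gs. P g xs)"
proof (induction gs)
  case Nil
  then show ?case by (simp add: computable_const)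
next
  case (Cons g gs)
  then have "decidable m (\<lambda>xs. P g xs \<and> (\<forall>g\<in>set gs. P g xs))"
    by (intro decidable_conj) auto
  then show ?case by simp
qed

text \<open>The node in front of the arguments serves both as oracle and as bound. The arity varies
  in the induction because subprograms take different numbers of arguments.\<close>

lemma computable_bounded_eval:
  "computable (Suc m) (\<lambda>ys. bounded_eval (ancestors (ys ! 0)) (ys ! 0) p (tl ys))"
  (is "computable _ (?E p)")
proof (induction p arbitrary: m)
  case Zero
  then show ?case by (simp add: computable_const)
next
  case Succ
  \<comment> \<open>For a fixed arity the length test is a constant. The index \<open>m\<close>
    equals \<open>1\<close> if the test succeeds and is in range in any case.\<close>
  have "computable (Suc m) (\<lambda>ys. if m = 1 then Suc (Suc (ys ! m)) else 0)"
    by (intro computable_intros) simp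
  then show ?case by (rule computable_cong) (auto simp: nth_tl)
next
  case (Proj i)
  \<comment> \<open>The minimum keeps the index in range when the projection diverges.\<close>
  have "computable (Suc m) (\<lambda>ys. if i < m then Suc (ys ! (min (Suc i) m)) else 0)"
    by (intro computable_intros) simp
  then show ?case by (rule computable_cong) (auto simp: nth_tl)
next
  case Oracle
  have "computable (Suc m) (\<lambda>ys. if m = 1 \<and> ys ! m \<le> ys ! 0
      then Suc (of_bool (ys ! m \<in> ancestors (ys ! 0))) else 0)"
    by (intro computable_intros) simp_all
  then show ?case by (rule computable_cong) (auto simp: nth_tl)
next
  case (Comp f gs)
  let ?hs = "(\<lambda>ys. ys ! 0) # map (\<lambda>g ys. ?E g ys - 1) gs"
  have "computable (Suc m) (\<lambda>ys. ?E f (map (\<lambda>h. h ys) ?hs))"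
    by (rule computable_Comp) (auto intro!: Comp computable_nth computable_diff computable_const)
  moreover have "decidable (Suc m) (\<lambda>ys. \<forall>g\<in>set gs. ?E g ys \<noteq> 0)"
    by (rule decidable_Ball_list) (intro computable_intros Comp)
  ultimately have "computable (Suc m) (\<lambda>ys. if \<forall>g\<in>set gs. ?E g ys \<noteq> 0
      then ?E f (map (\<lambda>h. h ys) ?hs) else 0)"
    by (intro computable_intros)
  then show ?case by (rule computable_cong) (auto simp: comp_def)
next
  case (PrimRec f g)
  show ?case
  proof (cases m)
    case 0
    then show ?thesis
      by (intro computable_cong[OF computable_const[of _ 0]]) (auto simp: length_Suc_conv)
  next
    case (Suc k)
    let ?step = "\<lambda>n r ys. if r = 0 then 0 else ?E g (ys ! 0 # n # (r - 1) # tl (tl ys))"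
    have "computable (2 + k) (\<lambda>ys. ?E f (map (\<lambda>h. h ys) [\<lambda>ys. ys ! 0] @ drop 2 ys))"
      using PrimRec(1)[of k] by (intro computable_append_drop) (auto intro: computable_nth)
    moreover have "2 + k = Suc m" using Suc by simp
    ultimately have base: "computable (Suc m) (\<lambda>ys. ?E f (ys ! 0 # tl (tl ys)))"
      by (simp add: numeral_2_eq_2 drop_Suc)
    \<comment> \<open>Inside the recursion the list starts with the counter, the previous result,
      the node and the recursion argument; the parameters follow after four entries.\<close>
    have "computable (4 + k) (\<lambda>ys. ?E g (map (\<lambda>h. h ys)
        [\<lambda>ys. ys ! 2, \<lambda>ys. ys ! 0, \<lambda>ys. ys ! 1 - 1] @ drop 4 ys))"
      using PrimRec(2)[of "Suc (Suc k)"]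
      by (intro computable_append_drop) (auto intro!: computable_nth computable_diff computable_const)
    moreover have "4 + k = Suc (Suc (Suc m))" using Suc by simp
    ultimately have "computable (Suc (Suc (Suc m)))
        (\<lambda>ys. ?E g (ys ! 2 # ys ! 0 # (ys ! 1 - 1) # drop 4 ys))"
      by simp
    then have "computable (Suc (Suc (Suc m))) (\<lambda>ys. if ys ! 1 = 0 then 0
        else ?E g (ys ! 2 # ys ! 0 # (ys ! 1 - 1) # drop 4 ys))"
      by (intro computable_if decidable_eq computable_const computable_nth) simp
    then have step: "computable (Suc (Suc (Suc m))) (\<lambda>ys. ?step (ys ! 0) (ys ! 1) (tl (tl ys)))"
      by (rule computable_cong) (auto simp: length_Suc_conv Suc numeral_eq_Suc)
    have "computable (Suc m) (\<lambda>ys. rec_nat (?E f (ys ! 0 # tl (tl ys))) (\<lambda>n r. ?step n r ys) (ys ! 1))"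
      by (rule computable_rec[OF base step]) (simp add: Suc computable_nth)
    then show ?thesis
      by (rule computable_cong) (auto simp: length_Suc_conv Suc cong: if_cong)
  qed
next
  case (Mu f)
  let ?h = "\<lambda>n ys. ?E f (ys ! 0 # n # tl ys)"
  \<comment> \<open>Two rearrangements are needed: one search variable precedes the node in the sum,
    and two precede it under the bounded quantifier.\<close>
  have "computable (2 + m) (\<lambda>ys. ?E f (map (\<lambda>h. h ys) [\<lambda>ys. ys ! 1, \<lambda>ys. ys ! 0] @ drop 2 ys))"
    using Mu[of "Suc m"] by (intro computable_append_drop) (auto intro: computable_nth)
  then have "computable (Suc (Suc m)) (\<lambda>ys. ?E f (ys ! 1 # ys ! 0 # drop 2 ys))" by simp
  then have 1: "computable (Suc (Suc m)) (\<lambda>ys. ?h (ys ! 0) (tl ys))"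
    by (rule computable_cong) (auto simp: length_Suc_conv numeral_2_eq_2)
  have "computable (3 + m) (\<lambda>ys. ?E f (map (\<lambda>h. h ys) [\<lambda>ys. ys ! 2, \<lambda>ys. ys ! 0] @ drop 3 ys))"
    using Mu[of "Suc m"] by (intro computable_append_drop) (auto intro: computable_nth)
  then have "computable (Suc (Suc (Suc m))) (\<lambda>ys. ?E f (ys ! 2 # ys ! 0 # drop 3 ys))"
    by (simp add: numeral_3_eq_3)
  then have 2: "computable (Suc (Suc (Suc m))) (\<lambda>ys. ?h (ys ! 0) (tl (tl ys)))"
    by (rule computable_cong) (auto simp: length_Suc_conv numeral_eq_Suc)
  have "computable (Suc m) (\<lambda>ys. \<Sum>n<Suc (ys ! 0). if ?h n ys = 1 \<and> (\<forall>m<n. 1 < ?h m ys)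
      then Suc n else 0)"
    by (intro computable_intros 1 2) simp_all
  then show ?case by simp
qed

text \<open>This turns the sum in the \<open>Mu\<close> clause of \<open>bounded_eval\<close> into a
  search: minimality leaves a single nonzero summand.\<close>

lemma sum_unique_Suc:
  assumes "\<And>m n. C m \<Longrightarrow> C n \<Longrightarrow> m = n" "C n" "n < N"
  shows "(\<Sum>n<N. if C n then Suc n else 0) = Suc n"
proof -
  have "(\<Sum>n<N. if C n then Suc n else 0) = (\<Sum>m<N. if n = m then Suc m else 0)"
    using assms(1,2) by (intro sum.cong) auto
  with assms(3) show ?thesis by simp
qed

lemma bounded_search_unique:
  fixes h :: "nat \<Rightarrow> nat"
  assumes "h m = 1 \<and> (\<forall>i<m. 1 < h i)" "h n = 1 \<and> (\<forall>i<n. 1 < h i)"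
  shows "m = n"
  using assms by (metis less_irrefl linorder_neqE_nat)

text \<open>The use principle: queries beyond \<open>b\<close> are never answered, so only the
  oracle up to \<open>b\<close> matters.\<close>

lemma bounded_eval_cong:
  assumes "A \<inter> {..b} = Y \<inter> {..b}"
  shows "bounded_eval A b p = bounded_eval Y b p"
proof (induction p)
  case Oracle
  have "x \<in> A \<longleftrightarrow> x \<in> Y" if "x \<le> b" for x using assms that by blast
  then show ?case by (auto simp: fun_eq_iff)
next
  case (Comp f gs)
  then have "map (bounded_eval A b) gs = map (bounded_eval Y b) gs" by simp
  with Comp(1) show ?case by (simp only: bounded_eval.simps)
qed (simp_all cong: if_cong)

lemma bounded_eval_sound: "bounded_eval Y b p xs = Suc y \<Longrightarrow> eval Y p xs y"
proof (induction p arbitrary: xs y)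
  case Zero
  then show ?case by (simp add: eval_Zero)
next
  case Succ
  then show ?case by (cases xs) (auto split: if_splits intro: eval_Succ)
next
  case (Proj i)
  then show ?case by (auto split: if_splits intro: eval_Proj)
next
  case Oracle
  then obtain x where "xs = [x]" by (cases xs) (auto split: if_splits)
  with Oracle show ?case by (auto split: if_splits simp del: of_bool_eq intro: eval_Oracle)
next
  case (Comp f gs)
  let ?ys = "map (\<lambda>g. bounded_eval Y b g xs - 1) gs"
  have gs: "bounded_eval Y b g xs \<noteq> 0" if "g \<in> set gs" for g
    using Comp.prems that by (auto split: if_splits)
  then have "bounded_eval Y b f ?ys = Suc y"
    using Comp.prems by (simp add: comp_def split: if_splits)
  then have "eval Y f ?ys y" by (rule Comp.IH(1))
  moreover have "eval Y g xs (bounded_eval Y b g xs - 1)" if "g \<in> set gs" for g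
    by (rule Comp.IH(2)[OF that]) (use gs[OF that] in simp)
  then have "list_all2 (\<lambda>g y. eval Y g xs y) gs ?ys"
    by (simp add: list_all2_conv_all_nth)
  ultimately show ?case by (rule eval_Comp[rotated])
next
  case (PrimRec f g)
  then obtain n zs where xs: "xs = n # zs" by (cases xs) auto
  let ?r = "rec_nat (bounded_eval Y b f zs)
      (\<lambda>n r. if r = 0 then 0 else bounded_eval Y b g (n # (r - 1) # zs))"
  have "?r n = Suc y \<Longrightarrow> eval Y (PrimRec f g) (n # zs) y" for n y
  proof (induction n arbitrary: y)
    case 0
    then show ?case using PrimRec.IH(1) by (intro eval_PrimRec_0) simp
  next
    case (Suc n)
    then have "?r n \<noteq> 0" by (auto split: if_splits)
    then obtain r where r: "?r n = Suc r" using not0_implies_Suc by blast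
    with Suc.prems have "bounded_eval Y b g (n # r # zs) = Suc y" by simp
    then show ?case using Suc.IH[OF r] PrimRec.IH(2) by (intro eval_PrimRec_Suc)
  qed
  then show ?case using PrimRec.prems xs by (simp cong: if_cong)
next
  case (Mu f)
  let ?C = "\<lambda>n. bounded_eval Y b f (n # xs) = 1 \<and> (\<forall>m<n. 1 < bounded_eval Y b f (m # xs))"
  have eq: "(\<Sum>n<Suc b. if ?C n then Suc n else 0) = Suc y"
    using Mu.prems by (simp only: bounded_eval.simps)
  \<comment> \<open>An unsuccessful search sums to \<open>0\<close>, the value that means
    divergence.\<close>
  have "\<exists>n<Suc b. ?C n"
  proof (rule ccontr)
    assume "\<not> (\<exists>n<Suc b. ?C n)"
    then have "(\<Sum>n<Suc b. if ?C n then Suc n else 0) = 0"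
      by (intro sum.neutral ballI if_not_P) (blast dest: lessThan_iff[THEN iffD1])
    with eq show False by simp
  qed
  then obtain n where n: "n < Suc b" "?C n" by blast
  have "?C i \<Longrightarrow> ?C j \<Longrightarrow> i = j" for i j
    by (rule bounded_search_unique[of "\<lambda>n. bounded_eval Y b f (n # xs)"])
  from sum_unique_Suc[of ?C, OF this n(2,1)] have "Suc n = Suc y" using eq by (rule trans[OF sym])
  then have "y = n" by simp
  have "eval Y f (y # xs) 0" using n(2) unfolding \<open>y = n\<close> by (intro Mu.IH) simp
  moreover have "\<exists>z>0. eval Y f (m # xs) z" if "m < y" for m
  proof (intro exI conjI)
    have m: "1 < bounded_eval Y b f (m # xs)" using n(2) that unfolding \<open>y = n\<close> by blast
    then show "0 < bounded_eval Y b f (m # xs) - 1" by simp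
    show "eval Y f (m # xs) (bounded_eval Y b f (m # xs) - 1)" using m by (intro Mu.IH) simp
  qed
  ultimately show ?case by (rule eval_Mu)
qed

text \<open>A halting computation has finitely many subcomputations, each correct from some bound
  on; the eventual form provides a common bound for them.\<close>

lemma bounded_eval_complete:
  "eval Y p xs y \<Longrightarrow> \<forall>\<^sub>F b in sequentially. bounded_eval Y b p xs = Suc y"
proof (induction rule: eval.induct)
  case (eval_Oracle x)
  show ?case using eventually_ge_at_top[of x] by eventually_elim simp
next
  case (eval_Comp xs gs ys f z)
  have "\<forall>\<^sub>F b in sequentially. \<forall>i\<in>{..<length gs}. bounded_eval Y b (gs ! i) xs = Suc (ys ! i)"
    using eval_Comp.IH(1) by (intro eventually_ball_finite) (auto simp: list_all2_conv_all_nth)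
  with eval_Comp.IH(2) show ?case
  proof eventually_elim
    case (elim b)
    have "length gs = length ys" using eval_Comp.IH(1) by (rule list_all2_lengthD)
    with elim(2) have "map (\<lambda>g. bounded_eval Y b g xs - 1) gs = ys"
      by (intro nth_equalityI) auto
    moreover have "\<forall>g\<in>set gs. bounded_eval Y b g xs \<noteq> 0"
      using elim(2) by (auto simp: in_set_conv_nth)
    ultimately show ?case using elim(1) by (simp add: comp_def)
  qed
next
  case (eval_PrimRec_Suc f g n xs r y)
  from eval_PrimRec_Suc.IH show ?case by eventually_elim (simp cong: if_cong)
next
  case (eval_Mu f n xs)
  have "\<forall>\<^sub>F b in sequentially. 1 < bounded_eval Y b f (m # xs)" if "m \<in> {..<n}" for m
  proof -
    obtain z where z: "0 < z" "\<forall>\<^sub>F b in sequentially. bounded_eval Y b f (m # xs) = Suc z"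
      using eval_Mu.IH(2) \<open>m \<in> {..<n}\<close> by blast
    from z(2) show ?thesis by eventually_elim (use z(1) in simp)
  qed
  then have "\<forall>\<^sub>F b in sequentially. \<forall>m\<in>{..<n}. 1 < bounded_eval Y b f (m # xs)"
    by (intro eventually_ball_finite) auto
  with eval_Mu.IH(1) eventually_ge_at_top[of n] show ?case
  proof eventually_elim
    case (elim b)
    let ?C = "\<lambda>n. bounded_eval Y b f (n # xs) = 1 \<and> (\<forall>m<n. 1 < bounded_eval Y b f (m # xs))"
    have "?C i \<Longrightarrow> ?C j \<Longrightarrow> i = j" for i j
      by (rule bounded_search_unique[of "\<lambda>n. bounded_eval Y b f (n # xs)"])
    moreover have "?C n" using elim by auto
    moreover have "n < Suc b" using elim by simp
    ultimately have "(\<Sum>n<Suc b. if ?C n then Suc n else 0) = Suc n"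
      by (rule sum_unique_Suc[of ?C])
    then show ?case by (simp only: bounded_eval.simps)
  qed
qed simp_all

section \<open>The test capturing the output\<close>

definition outputs :: "prog \<Rightarrow> nat list \<Rightarrow> nat set" where
  "outputs p v = {y. \<forall>m<length v. bounded_eval (ancestors y) y p [m] = Suc (v ! m)}"

text \<open>
  In \<open>candidate p i e z\<close>, the number \<open>z\<close> codes a finite tree and a string of length \<open>i\<close> that is
  the output at all its leaves, and \<open>e\<close> codes the pair of \<open>k\<close> and \<open>x\<close> from a forcing condition.
  Since a string of length \<open>Suc (j + e)\<close> enters level \<open>j\<close> of the test \<open>capture p\<close> only for the least
  candidate, the lengths of the strings in a level are distinct.
\<close>

definition candidate :: "prog \<Rightarrow> nat \<Rightarrow> nat \<Rightarrow> nat \<Rightarrow> bool" where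
  "candidate p i e z \<longleftrightarrow> (let F = set (list_decode (fst (prod_decode z)));
      v = list_decode (snd (prod_decode z)) in
    length v = i \<and> (\<forall>m<i. v ! m \<le> 1) \<and>
    big_witness (fst (prod_decode e)) (outputs p v) (snd (prod_decode e)) F)"

definition capture :: "prog \<Rightarrow> nat \<Rightarrow> bool list set" where
  "capture p j = {w. j < length w \<and>
    (\<exists>z. candidate p (length w) (length w - Suc j) z \<and>
      (\<forall>z'<z. \<not> candidate p (length w) (length w - Suc j) z') \<and>
      snd (prod_decode z) = string_code w)}"

lemma computable_comp3:
  assumes "computable 3 (\<lambda>ys. f (ys ! 0) (ys ! 1) (ys ! 2))"
    "computable m a" "computable m b" "computable m c"
  shows "computable m (\<lambda>xs. f (a xs) (b xs) (c xs))"
  using computable_Comp[of "[a, b, c]" "\<lambda>ys. f (ys ! 0) (ys ! 1) (ys ! 2)" m] assms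
  by (auto simp: numeral_2_eq_2 numeral_3_eq_3)

lemma computable_bounded_eval_node [computable_intros]:
  assumes "computable m a" "computable m b"
  shows "computable m (\<lambda>xs. bounded_eval (ancestors (a xs)) (a xs) p [b xs])"
  using computable_Comp[of "[a, b]" "\<lambda>ys. bounded_eval (ancestors (ys ! 0)) (ys ! 0) p (tl ys)" m]
    computable_bounded_eval[of 1 p] assms by auto

lemma decidable_candidate [computable_intros]:
  assumes "computable m a" "computable m b" "computable m c"
  shows "decidable m (\<lambda>xs. candidate p (a xs) (b xs) (c xs))"
proof -
  \<comment> \<open>The same condition with bounded quantifiers, a bounded sum for the cardinality
    and \<open>list_entry\<close> for list access; members of a coded list lie below its
    code.\<close>
  have *: "candidate p i e z \<longleftrightarrow>
    length (list_decode (snd (prod_decode z))) = i \<and>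
    (\<forall>m<i. list_entry (snd (prod_decode z)) m \<le> 1) \<and>
    snd (prod_decode e) \<in> set (list_decode (fst (prod_decode z))) \<and>
    (\<forall>y<fst (prod_decode z). y \<in> set (list_decode (fst (prod_decode z))) \<longrightarrow>
      (\<forall>m<length (list_decode (snd (prod_decode z))).
        bounded_eval (ancestors y) y p [m] = Suc (list_entry (snd (prod_decode z)) m)) \<or>
      fst (prod_decode e) \<le> (\<Sum>c<fst (prod_decode z). of_bool
        (c \<in> set (list_decode (fst (prod_decode z))) \<and> \<not> c = 0 \<and> parent c = y)))"
    for i e z
  proof -
    define s v where sv: "s = fst (prod_decode z)" "v = snd (prod_decode z)"
    have 1: "card (set (list_decode s) \<inter> children y) = (\<Sum>c<s. of_bool
        (c \<in> set (list_decode s) \<and> \<not> c = 0 \<and> parent c = y))" for y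
    proof -
      have "set (list_decode s) \<inter> children y =
          {c \<in> {..<s}. c \<in> set (list_decode s) \<and> \<not> c = 0 \<and> parent c = y}"
        using elem_less_list_decode[of _ s] by (auto simp: children_def)
      then show ?thesis by (simp add: of_bool_def sum.If_cases Int_def)
    qed
    have 2: "(\<forall>y<s. y \<in> set (list_decode s) \<longrightarrow> Q y) \<longleftrightarrow> (\<forall>y\<in>set (list_decode s). Q y)" for Q
      using elem_less_list_decode by blast
    have 3: "(\<forall>m<i. list_decode v ! m \<le> 1) \<longleftrightarrow> (\<forall>m<i. list_entry v m \<le> 1)" if "length (list_decode v) = i"
      using that by (auto simp: list_entry_eq)
    have 4: "y \<in> outputs p (list_decode v) \<longleftrightarrow> (\<forall>m<length (list_decode v).
        bounded_eval (ancestors y) y p [m] = Suc (list_entry v m))" for y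
      by (auto simp: outputs_def list_entry_eq)
    show ?thesis
      unfolding candidate_def Let_def big_witness_def sv[symmetric]
      by (simp only: 1 2 3 4 cong: conj_cong)
  qed
  have "decidable 3 (\<lambda>ys. candidate p (ys ! 0) (ys ! 1) (ys ! 2))"
    unfolding * by (intro computable_intros) simp_all
  from computable_comp3[of "\<lambda>i e z. of_bool (candidate p i e z)", OF this assms] show ?thesis .
qed

lemma list_decode_string_code: "list_decode (string_code w) = map of_bool w"
  by (simp add: string_code_def)

lemma uniformly_ce_capture: "uniformly_ce (capture p)"
proof -
  define M where "M z j c \<longleftrightarrow> j < length (list_decode c) \<and>
      candidate p (length (list_decode c)) (length (list_decode c) - Suc j) z \<and>
      (\<forall>z'<z. \<not> candidate p (length (list_decode c)) (length (list_decode c) - Suc j) z') \<and>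
      snd (prod_decode z) = c" for z j c
  have "decidable 3 (\<lambda>xs. M (xs ! 0) (xs ! 1) (xs ! 2))"
    unfolding M_def by (intro computable_intros) simp_all
  then obtain P where P: "\<And>n c. (\<exists>z. M z n c) \<longleftrightarrow> (\<exists>y. eval {} P [n, c] y)"
    using semidecidable_ex[of M] by blast
  have "w \<in> capture p j \<longleftrightarrow> (\<exists>z. M z j (string_code w))" for w j
    by (simp add: capture_def M_def list_decode_string_code)
  then show ?thesis unfolding uniformly_ce_def P by blast
qed

text \<open>Within one level the length fixes both \<open>i\<close> and \<open>e\<close>. The least
  candidate for them is unique and carries the code of the string.\<close>

lemma inj_on_length_capture: "inj_on length (capture p j)"
proof (rule inj_onI)
  fix w w' assume *: "w \<in> capture p j" "w' \<in> capture p j" "length w = length w'"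
  let ?C = "candidate p (length w) (length w - Suc j)"
  obtain z where z: "?C z" "\<And>y. y < z \<Longrightarrow> \<not> ?C y" "snd (prod_decode z) = string_code w"
    using *(1) by (auto simp: capture_def)
  obtain z' where z': "?C z'" "\<And>y. y < z' \<Longrightarrow> \<not> ?C y" "snd (prod_decode z') = string_code w'"
    using *(2) by (auto simp: capture_def *(3))
  have "z = z'" using z(1,2) z'(1,2) by (metis linorder_neqE_nat)
  then have "map of_bool w = (map of_bool w' :: nat list)"
    using z(3) z'(3) by (metis list_encode_inverse string_code_def)
  moreover have "inj (of_bool :: bool \<Rightarrow> nat)" by (rule injI) (simp only: of_bool_eq_iff)
  ultimately show "w = w'" using inj_map_eq_map by blast
qed

text \<open>Level \<open>n\<close> has at most one string of each length above \<open>n\<close>, so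
  its weight is bounded by a geometric sum starting at \<open>Suc n\<close>.\<close>

lemma ml_test_capture: "ml_test (capture p)"
  unfolding ml_test_def
proof (intro conjI allI uniformly_ce_capture)
  fix n
  have geom: "(\<Sum>i\<in>{Suc n..<Suc n + k}. (1/2::real) ^ i) = (1/2) ^ n - (1/2) ^ (n + k)" for k
  proof (induction k)
    case (Suc k)
    have "(\<Sum>i\<in>{Suc n..<Suc n + Suc k}. (1/2::real) ^ i) =
        (\<Sum>i\<in>{Suc n..<Suc n + k}. (1/2) ^ i) + (1/2) ^ Suc (n + k)"
      by (simp only: add_Suc_right add_Suc) (rule sum.atLeastLessThan_Suc, simp)
    with Suc show ?case by simp
  qed simp
  have le: "(\<Sum>w\<in>F. (1/2::real) ^ length w) \<le> (1/2) ^ n" if F: "finite F" "F \<subseteq> capture p n" for F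
  proof -
    have "(\<Sum>w\<in>F. (1/2::real) ^ length w) = (\<Sum>i\<in>length ` F. (1/2) ^ i)"
      using inj_on_subset[OF inj_on_length_capture F(2)] by (simp add: sum.reindex)
    also have "\<dots> \<le> (\<Sum>i\<in>{Suc n..<Suc n + Suc (Max (length ` F))}. (1/2) ^ i)"
    proof (rule sum_mono2)
      show "length ` F \<subseteq> {Suc n..<Suc n + Suc (Max (length ` F))}"
      proof
        fix i assume i: "i \<in> length ` F"
        then have "i \<le> Max (length ` F)" using F(1) by simp
        moreover have "n < i" using i F(2) by (auto simp: capture_def)
        ultimately show "i \<in> {Suc n..<Suc n + Suc (Max (length ` F))}" by simp
      qed
    qed simp_all
    also have "\<dots> \<le> (1/2) ^ n" unfolding geom by simp
    finally show ?thesis .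
  qed
  show summable: "(\<lambda>w. (1/2 :: real) ^ length w) summable_on capture p n"
    by (rule nonneg_bdd_above_summable_on) (auto intro!: bdd_aboveI[of _ "(1/2) ^ n"] le)
  show "(\<Sum>\<^sub>\<infinity>w\<in>capture p n. (1/2 :: real) ^ length w) \<le> (1/2) ^ n"
    by (rule infsum_le_finite_sums[OF summable le])
qed

text \<open>
  By the pigeonhole principle for largeness, one of the \<open>2 ^ i\<close> possible outputs of length \<open>i\<close> is
  taken on a \<open>k\<close>-big set, and a \<open>k\<close>-big set has a node above which \<open>B\<close> is still small.
\<close>

lemma capture_extend:
  fixes j k x :: nat
  defines "i \<equiv> Suc j + prod_encode (k, x)"
  assumes small: "\<not> big k B x"
    and big: "big (k * 2 ^ i) {y. \<forall>m<i. \<exists>b. bounded_eval (ancestors y) y p [m] = Suc (of_bool b)} x"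
  shows "\<exists>w\<in>capture p j. \<exists>y. x \<in> ancestors y \<and> \<not> big k B y \<and>
    (\<forall>m<length w. bounded_eval (ancestors y) y p [m] = Suc (of_bool (w ! m)))"
proof -
  let ?V = "{v. set v \<subseteq> {0, 1::nat} \<and> length v = i}"
  have "y \<in> (\<Union>v\<in>?V. outputs p v)"
    if y: "\<forall>m<i. \<exists>b. bounded_eval (ancestors y) y p [m] = Suc (of_bool b)" for y
  proof
    let ?v = "map (\<lambda>m. bounded_eval (ancestors y) y p [m] - 1) [0..<i]"
    show "?v \<in> ?V" using y by fastforce
    show "y \<in> outputs p ?v" using y by (fastforce simp: outputs_def)
  qed
  then have "big (k * 2 ^ i) (\<Union>v\<in>?V. outputs p v) x"
    by (intro big_subst[OF big]) (auto intro: big.leaf)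
  moreover have "card ?V = 2 ^ i" "finite ?V"
    using card_lists_length_eq[of "{0, 1::nat}" i] finite_lists_length_eq[of "{0, 1::nat}" i]
    by (auto simp: numeral_2_eq_2)
  moreover have "replicate i 0 \<in> ?V" by auto
  then have "?V \<noteq> {}" by blast
  ultimately have "\<exists>v\<in>?V. big k (outputs p v) x" by (intro big_UN) simp_all
  then obtain v where v: "set v \<subseteq> {0, 1}" "length v = i" "big k (outputs p v) x" by blast
  then obtain F where F: "finite F" "big_witness k (outputs p v) x F"
    unfolding big_iff_witness by blast
  let ?C = "candidate p i (prod_encode (k, x))"
  have "v ! m \<le> 1" if "m < i" for m
  proof -
    have "v ! m \<in> {0, 1}" using v(1) nth_mem[of m v] v(2) that by blast
    then show ?thesis by auto
  qed
  then have "?C (prod_encode (list_encode (sorted_list_of_set F), list_encode v))"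
    using F v(2) by (simp add: candidate_def)
  then have "?C (LEAST z. ?C z)" by (rule LeastI)
  moreover have "\<not> ?C z'" if "z' < (LEAST z. ?C z)" for z' using not_less_Least[OF that] .
  ultimately obtain z where z: "?C z" "\<And>z'. z' < z \<Longrightarrow> \<not> ?C z'" by blast
  \<comment> \<open>The least candidate may code another string than \<open>v\<close>, so the
    argument continues with its own string \<open>u\<close>.\<close>
  define u where "u = list_decode (snd (prod_decode z))"
  have u: "length u = i" "\<And>m. m < i \<Longrightarrow> u ! m \<le> 1"
    "big_witness k (outputs p u) x (set (list_decode (fst (prod_decode z))))"
    using z(1) by (simp_all add: candidate_def Let_def u_def)
  define w where "w = map (\<lambda>n. n = 1) u"
  have nth: "of_bool (w ! m) = u ! m" if "m < i" for m
    using u(2)[OF that] u(1) that by (simp add: w_def)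
  then have "map of_bool w = u" using u(1) by (intro nth_equalityI) (auto simp: w_def)
  then have "string_code w = snd (prod_decode z)" by (simp add: string_code_def u_def)
  moreover have "length w = i" using u(1) by (simp add: w_def)
  ultimately have "w \<in> capture p j"
    using z by (auto simp: capture_def i_def)
  moreover have "big k (outputs p u) x" using u(3) unfolding big_iff_witness by blast
  \<comment> \<open>If \<open>B\<close> were big above all these outputs, grafting would make it big
    above \<open>x\<close>.\<close>
  then have "\<exists>y\<in>outputs p u. x \<in> ancestors y \<and> \<not> big k B y"
    using big_subst[of k "outputs p u" x B] small by blast
  then obtain y where y: "y \<in> outputs p u" "x \<in> ancestors y" "\<not> big k B y" by blast
  moreover have "\<forall>m<length w. bounded_eval (ancestors y) y p [m] = Suc (of_bool (w ! m))"
    using y(1) nth u(1) \<open>length w = i\<close> by (simp add: outputs_def)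
  ultimately show ?thesis by blast
qed

section \<open>Random supersets\<close>

text \<open>Sequential compactness of Cantor space: the bits of \<open>S\<close> are fixed one at a
  time, always keeping infinitely many indices \<open>n\<close>.\<close>

lemma cluster_point: "\<exists>S. \<forall>m. infinite {n::nat. R n \<inter> {..<m} = S \<inter> {..<m::nat}}"
proof -
  have "\<exists>f. \<forall>m. infinite {n. R n \<inter> {..<m} = f m} \<and> f (Suc m) \<inter> {..<m} = f m \<inter> {..<m}"
  proof (rule dependent_nat_choice)
    show "\<exists>D. infinite {n. R n \<inter> {..<0} = D}" by (intro exI[of _ "{}"]) simp
    fix D m assume inf: "infinite {n. R n \<inter> {..<m} = D}"
    have "{n. R n \<inter> {..<m} = D} \<subseteq>
        {n. R n \<inter> {..<Suc m} = D} \<union> {n. R n \<inter> {..<Suc m} = insert m D}"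
      by (auto simp: lessThan_Suc)
    then have "infinite {n. R n \<inter> {..<Suc m} = D} \<or> infinite {n. R n \<inter> {..<Suc m} = insert m D}"
      using inf by (meson finite_UnI finite_subset)
    moreover have "D \<inter> {..<m} = D \<inter> {..<m}" "insert m D \<inter> {..<m} = D \<inter> {..<m}" by auto
    ultimately show "\<exists>D'. infinite {n. R n \<inter> {..<Suc m} = D'} \<and> D' \<inter> {..<m} = D \<inter> {..<m}" by blast
  qed
  then obtain f where f: "\<And>m. infinite {n. R n \<inter> {..<m} = f m}"
    "\<And>m. f (Suc m) \<inter> {..<m} = f m \<inter> {..<m}" by blast
  define S where "S = {i. i \<in> f (Suc i)}"
  have "f m = S \<inter> {..<m}" for m
  proof (induction m)
    case 0
    obtain n where "R n \<inter> {..<0} = f 0" using not_finite_existsD[OF f(1)[of 0]] by blast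
    then show ?case by simp
  next
    case (Suc m)
    obtain n where "R n \<inter> {..<Suc m} = f (Suc m)" using not_finite_existsD[OF f(1)[of "Suc m"]] by blast
    then have "f (Suc m) \<subseteq> {..<Suc m}" by blast
    then have "f (Suc m) = (f (Suc m) \<inter> {..<m}) \<union> (f (Suc m) \<inter> {m})" by (auto simp: lessThan_Suc)
    also have "\<dots> = (S \<inter> {..<m}) \<union> (S \<inter> {m})" using Suc f(2)[of m] by (auto simp: S_def)
    finally show ?case by (auto simp: lessThan_Suc)
  qed
  with f(1) show ?thesis by metis
qed

lemma cluster_point_above:
  assumes "infinite {n::nat. R n \<inter> {..<m} = S \<inter> {..<m::nat}}"
  obtains n where "k \<le> n" "R n \<inter> {..<m} = S \<inter> {..<m}"
  using assms unfolding infinite_nat_iff_unbounded_le by blast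

lemma cylinder_cong:
  "R \<inter> {..<length w} = S \<inter> {..<length w} \<Longrightarrow> R \<in> cylinder w \<longleftrightarrow> S \<in> cylinder w"
  unfolding cylinder_def by blast

instance prog :: countable
  by countable_datatype

text \<open>There are only countably many tests, so one level of each covers all non-random sets.\<close>

lemma random_complement:
  "\<exists>W. (\<forall>X. X \<notin> open_of W \<longrightarrow> ml_random X) \<and>
    (\<forall>F. finite F \<longrightarrow> F \<subseteq> W \<longrightarrow> (\<Sum>w\<in>F. (1/2::real) ^ length w) \<le> 1/8)"
proof -
  \<comment> \<open>Countability of \<open>prog\<close> lets \<open>T m\<close> run through all
    uniformly c.e. sequences.\<close>
  define T where "T m n = {w. \<exists>y. eval {} (from_nat m) [n, string_code w] y}" for m n
  \<comment> \<open>The shift by 4 makes the weights \<open>(1/2) ^ (m + 4)\<close> add up to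
    \<open>1/8\<close>.\<close>
  define W where "W = (\<Union>m\<in>{m. ml_test (T m)}. T m (m + 4))"
  have "ml_random X" if "X \<notin> open_of W" for X
    unfolding ml_random_def
  proof (intro allI impI)
    fix U assume U: "ml_test U"
    then obtain p where p: "\<And>n w. w \<in> U n \<longleftrightarrow> (\<exists>y. eval {} p [n, string_code w] y)"
      unfolding ml_test_def uniformly_ce_def by blast
    have UT: "U = T (to_nat p)" using p by (auto simp: T_def fun_eq_iff)
    then have "U (to_nat p + 4) \<subseteq> W" using U unfolding W_def by auto
    then have "X \<notin> open_of (U (to_nat p + 4))" using that by (auto simp: open_of_def)
    then show "X \<notin> (\<Inter>n. open_of (U n))" by blast
  qed
  moreover have "(\<Sum>w\<in>F. (1/2::real) ^ length w) \<le> 1/8" if F: "finite F" "F \<subseteq> W" for F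
  proof -
    have "\<forall>w\<in>F. \<exists>m. ml_test (T m) \<and> w \<in> T m (m + 4)" using F(2) unfolding W_def by blast
    \<comment> \<open>Each string is charged to one test that contributes it, which splits the sum
      by tests.\<close>
    from bchoice[OF this] obtain h where h: "\<And>w. w \<in> F \<Longrightarrow> ml_test (T (h w)) \<and> w \<in> T (h w) (h w + 4)"
      by blast
    have "(\<Sum>w | w \<in> F \<and> h w = m. (1/2::real) ^ length w) \<le> (1/2) ^ (m + 4)" if "m \<in> h ` F" for m
    proof -
      have T: "ml_test (T m)" using h that by blast
      then have "(\<Sum>w | w \<in> F \<and> h w = m. (1/2::real) ^ length w) \<le>
          (\<Sum>\<^sub>\<infinity>w\<in>T m (m + 4). (1/2) ^ length w)"
        using F(1) h by (intro finite_sum_le_infsum) (auto simp: ml_test_def)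
      also have "\<dots> \<le> (1/2) ^ (m + 4)" using T unfolding ml_test_def by blast
      finally show ?thesis .
    qed
    then have "(\<Sum>w\<in>F. (1/2::real) ^ length w) \<le> (\<Sum>m\<in>h ` F. (1/2) ^ (m + 4))"
      unfolding sum.image_gen[OF F(1), of _ h] by (rule sum_mono)
    also have "\<dots> \<le> (\<Sum>m<Suc (Max (h ` F)). (1/2) ^ (m + 4))"
      using F(1) by (intro sum_mono2) (auto simp: less_Suc_eq_le)
    also have "\<dots> \<le> 1/8"
    proof -
      have "(\<Sum>m<k. (1/2::real) ^ (m + 4)) = 1/8 - (1/2) ^ (k + 3)" for k
        by (induction k) (simp_all add: field_simps eval_nat_numeral)
      then show ?thesis by simp
    qed
    finally show ?thesis .
  qed
  ultimately show ?thesis by blast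
qed

text \<open>A subset of \<open>M\<close> splits into its part in \<open>I\<close> and a free part in
  \<open>M - I\<close>. This computes, by counting, the measure of an event that depends only on
  \<open>I\<close>.\<close>

lemma card_restrict:
  assumes M: "finite M" "I \<subseteq> M" and E: "E \<subseteq> Pow I"
  shows "card {R. R \<subseteq> M \<and> R \<inter> I \<in> E} = card E * 2 ^ (card M - card I)"
proof -
  have "bij_betw (\<lambda>(D, Q). D \<union> Q) (E \<times> Pow (M - I)) {R. R \<subseteq> M \<and> R \<inter> I \<in> E}"
  proof (rule bij_betw_byWitness[where f' = "\<lambda>R. (R \<inter> I, R - I)"])
    show "\<forall>a\<in>E \<times> Pow (M - I). (\<lambda>R. (R \<inter> I, R - I)) (case a of (D, Q) \<Rightarrow> D \<union> Q) = a"
      using E by fastforce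
    show "\<forall>R\<in>{R. R \<subseteq> M \<and> R \<inter> I \<in> E}. (case (R \<inter> I, R - I) of (D, Q) \<Rightarrow> D \<union> Q) = R" by auto
    show "(\<lambda>(D, Q). D \<union> Q) ` (E \<times> Pow (M - I)) \<subseteq> {R. R \<subseteq> M \<and> R \<inter> I \<in> E}"
    proof clarify
      fix D Q assume D: "D \<in> E" "Q \<subseteq> M - I"
      then have "(D \<union> Q) \<inter> I = D" using E by blast
      moreover have "D \<union> Q \<subseteq> M" using D E M(2) by blast
      ultimately show "D \<union> Q \<subseteq> M \<and> (D \<union> Q) \<inter> I \<in> E" using D by simp
    qed
    show "(\<lambda>R. (R \<inter> I, R - I)) ` {R. R \<subseteq> M \<and> R \<inter> I \<in> E} \<subseteq> E \<times> Pow (M - I)" by auto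
  qed
  then have "card {R. R \<subseteq> M \<and> R \<inter> I \<in> E} = card (E \<times> Pow (M - I))"
    by (simp add: bij_betw_same_card)
  also have "\<dots> = card E * 2 ^ (card M - card I)"
    using M finite_subset[OF M(2,1)] by (simp add: card_cartesian_product card_Pow card_Diff_subset)
  finally show ?thesis .
qed

text \<open>Independence, cleared of denominators: events on disjoint coordinates with probability
  at least 1/4 each all fail with probability at most 3/4 to the power
  \<open>card C\<close>.\<close>

lemma card_avoiding:
  fixes J :: "'a \<Rightarrow> nat set"
  assumes "finite C" "\<And>c. c \<in> C \<Longrightarrow> finite (J c)" "\<And>c. c \<in> C \<Longrightarrow> E c \<subseteq> Pow (J c)"
    "\<And>c. c \<in> C \<Longrightarrow> 2 ^ card (J c) \<le> 4 * card (E c)" "disjoint_family_on J C"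
  shows "4 ^ card C * card {R. R \<subseteq> (\<Union>c\<in>C. J c) \<and> (\<forall>c\<in>C. R \<inter> J c \<notin> E c)} \<le>
    3 ^ card C * 2 ^ card (\<Union>c\<in>C. J c)"
  using assms
proof (induction C rule: finite_induct)
  case empty
  have "{R::nat set. R \<subseteq> {}} = {{}}" by auto
  then show ?case by simp
next
  case (insert c C)
  let ?K = "\<Union>c\<in>C. J c"
  let ?A = "{R. R \<subseteq> ?K \<and> (\<forall>c\<in>C. R \<inter> J c \<notin> E c)}"
  let ?A' = "{R. R \<subseteq> (\<Union>c\<in>insert c C. J c) \<and> (\<forall>c\<in>insert c C. R \<inter> J c \<notin> E c)}"
  have fin: "finite ?K" "finite (J c)" using insert by auto
  then have finA: "finite ?A" by simp
  have finE: "finite (E c)" using insert.prems(2) fin(2) by (meson finite_Pow_iff finite_subset insertI1)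
  have IH: "4 ^ card C * card ?A \<le> 3 ^ card C * 2 ^ card ?K"
    using insert.prems by (intro insert.IH) (auto simp: disjoint_family_on_def)
  have "?A' \<subseteq> (\<lambda>(R, Q). R \<union> Q) ` (?A \<times> (Pow (J c) - E c))"
  proof
    fix R assume R: "R \<in> ?A'"
    have "R \<inter> ?K \<inter> J d = R \<inter> J d" if "d \<in> C" for d using that by blast
    then have "R \<inter> ?K \<in> ?A" using R by auto
    moreover have "R \<inter> J c \<in> Pow (J c) - E c" using R by blast
    moreover have "R = R \<inter> ?K \<union> R \<inter> J c" using R by blast
    ultimately show "R \<in> (\<lambda>(R, Q). R \<union> Q) ` (?A \<times> (Pow (J c) - E c))"
      by (intro image_eqI[of _ _ "(R \<inter> ?K, R \<inter> J c)"]) simp_all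
  qed
  then have "card ?A' \<le> card (?A \<times> (Pow (J c) - E c))"
    using finA fin(2) by (meson card_image_le card_mono finite_Diff finite_Pow_iff finite_SigmaI
      finite_imageI le_trans)
  also have "\<dots> = card ?A * (2 ^ card (J c) - card (E c))"
    using finE fin(2) insert.prems(2)
    by (simp add: card_cartesian_product card_Diff_subset card_Pow)
  finally have "4 ^ card (insert c C) * card ?A' \<le>
      4 ^ card (insert c C) * (card ?A * (2 ^ card (J c) - card (E c)))"
    by (rule mult_le_mono2)
  also have "\<dots> = (4 ^ card C * card ?A) * (4 * (2 ^ card (J c) - card (E c)))"
    by (simp only: card_insert_disjoint[OF insert.hyps] power_Suc ac_simps)
  also have "\<dots> \<le> (3 ^ card C * 2 ^ card ?K) * (3 * 2 ^ card (J c))"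
    by (rule mult_le_mono[OF IH]) (use insert.prems(3)[of c] in simp)
  also have "\<dots> = 3 ^ card (insert c C) * 2 ^ card (\<Union>c\<in>insert c C. J c)"
  proof -
    have "J c \<inter> J d = {}" if "d \<in> C" for d
      using disjoint_family_onD[OF insert.prems(4), of c d] that insert.hyps(2) by blast
    then have "J c \<inter> ?K = {}" by blast
    then have "card (\<Union>c\<in>insert c C. J c) = card (J c) + card ?K"
      using fin by (simp add: card_Un_disjoint)
    then show ?thesis using insert.hyps by (simp add: power_add)
  qed
  finally show ?case .
qed

text \<open>
  A random set contains the path from \<open>x\<close> to some node of \<open>B\<close> with probability at least 1/4: given
  this for three children of \<open>x\<close>, all three fail with probability at most 27/64, and \<open>x\<close> itself
  belongs to a random set with probability 1/2.
\<close>

lemma big_probability: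
  assumes "big 3 B x"
  shows "\<exists>J E. finite J \<and> J \<subseteq> {z. x \<in> ancestors z} \<and> E \<subseteq> Pow J \<and> 2 ^ card J \<le> 4 * card E \<and>
    (\<forall>R\<in>E. \<exists>y\<in>B. x \<in> ancestors y \<and> {z \<in> ancestors y. x \<in> ancestors z} \<subseteq> R)"
  using assms
proof (induction rule: big.induct)
  case (leaf x)
  have "{z \<in> ancestors x. x \<in> ancestors z} \<subseteq> {x}" by (auto dest!: ancestors_le)
  then have "\<exists>y\<in>B. x \<in> ancestors y \<and> {z \<in> ancestors y. x \<in> ancestors z} \<subseteq> {x}"
    using leaf ancestors_refl by (intro bexI[of _ x] conjI)
  then show ?case
    by (intro exI[of _ "{x}"] exI[of _ "{{x}}"]) auto
next
  case (node C0 x)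
  obtain C where C: "C \<subseteq> C0" "card C = 3" "finite C"
    using obtain_subset_with_card_n[OF node.hyps(2)] by blast
  have "\<forall>c\<in>C. \<exists>JE. finite (fst JE) \<and> fst JE \<subseteq> {z. c \<in> ancestors z} \<and> snd JE \<subseteq> Pow (fst JE) \<and>
      2 ^ card (fst JE) \<le> 4 * card (snd JE) \<and>
      (\<forall>R\<in>snd JE. \<exists>y\<in>B. c \<in> ancestors y \<and> {z \<in> ancestors y. c \<in> ancestors z} \<subseteq> R)"
    using node.IH C(1) by (simp add: subset_iff)
  from bchoice[OF this] obtain JE where JE: "\<forall>c\<in>C. finite (fst (JE c)) \<and>
      fst (JE c) \<subseteq> {z. c \<in> ancestors z} \<and> snd (JE c) \<subseteq> Pow (fst (JE c)) \<and>
      2 ^ card (fst (JE c)) \<le> 4 * card (snd (JE c)) \<and>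
      (\<forall>R\<in>snd (JE c). \<exists>y\<in>B. c \<in> ancestors y \<and> {z \<in> ancestors y. c \<in> ancestors z} \<subseteq> R)" ..
  define J where "J c = fst (JE c)" for c
  define E where "E c = snd (JE c)" for c
  have fin: "\<And>c. c \<in> C \<Longrightarrow> finite (J c)" and J: "\<And>c z. c \<in> C \<Longrightarrow> z \<in> J c \<Longrightarrow> c \<in> ancestors z"
    and E: "\<And>c. c \<in> C \<Longrightarrow> E c \<subseteq> Pow (J c)" "\<And>c. c \<in> C \<Longrightarrow> 2 ^ card (J c) \<le> 4 * card (E c)"
    and path: "\<And>c R. c \<in> C \<Longrightarrow> R \<in> E c \<Longrightarrow>
      \<exists>y\<in>B. c \<in> ancestors y \<and> {z \<in> ancestors y. c \<in> ancestors z} \<subseteq> R"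
    using JE unfolding J_def E_def by blast+
  have ch: "c \<in> children x" if "c \<in> C" for c using that C(1) node.hyps(3) by blast
  have disj: "disjoint_family_on J C"
    unfolding disjoint_family_on_def
  proof (intro ballI impI equals0I)
    \<comment> \<open>A common descendant would make the smaller sibling an ancestor of the larger
      one, hence of \<open>x\<close>, although children exceed their parent.\<close>
    have *: False if "c \<in> C" "d \<in> C" "c < d" "z \<in> J c" "z \<in> J d" for c d z
    proof -
      have "c \<in> ancestors d" using ancestors_linear J that by (meson less_imp_le)
      then have "c \<in> ancestors x" using ancestors_children[OF ch[OF that(2)]] that(3) by auto
      then show False using ancestors_le children_greater[OF ch[OF that(1)]] by fastforce
    qed
    fix c d z assume "c \<in> C" "d \<in> C" "c \<noteq> d" "z \<in> J c \<inter> J d"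
    then show False using *[of c d z] *[of d c z] by (cases "c < d") auto
  qed
  let ?K = "\<Union>c\<in>C. J c"
  let ?A = "{R. R \<subseteq> ?K \<and> (\<forall>c\<in>C. R \<inter> J c \<notin> E c)}"
  have finK: "finite ?K" using fin C(3) by blast
  have "x \<notin> J c" if "c \<in> C" for c
    using J[OF that, of x] ancestors_le children_greater[OF ch[OF that]] by fastforce
  then have x: "x \<notin> ?K" by blast
  \<comment> \<open>Three children fail together with probability at most 27/64, which is below
    1/2.\<close>
  have "2 * card ?A \<le> 2 ^ card ?K"
    using card_avoiding[of C J E] C(2,3) fin E disj by simp
  \<comment> \<open>Success at some child together with membership of \<open>x\<close>, which costs
    another factor 2.\<close>
  define G where "G = insert x ` (Pow ?K - ?A)"
  have "inj_on (insert x) (Pow ?K - ?A)"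
  proof (rule inj_onI)
    fix R S assume RS: "R \<in> Pow ?K - ?A" "S \<in> Pow ?K - ?A" and eq: "insert x R = insert x S"
    have "x \<notin> R" "x \<notin> S" using RS x by (auto simp del: UN_iff)
    then show "R = S" using insert_ident[of x R S] eq by simp
  qed
  then have "card G = card (Pow ?K - ?A)" unfolding G_def by (rule card_image)
  also have "\<dots> = 2 ^ card ?K - card ?A"
  proof -
    have "?A \<subseteq> Pow ?K" by blast
    then show ?thesis using finK by (simp add: card_Diff_subset card_Pow finite_subset)
  qed
  finally have G1: "2 ^ card (insert x ?K) \<le> 4 * card G"
    using \<open>2 * card ?A \<le> 2 ^ card ?K\<close> x finK by simp
  have G2: "insert x ?K \<subseteq> {z. x \<in> ancestors z}"
  proof -
    have "x \<in> ancestors z" if "c \<in> C" "z \<in> J c" for c z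
    proof (rule ancestors_trans[OF _ J[OF that]])
      show "x \<in> ancestors c" using ancestors_children[OF ch[OF that(1)]] by simp
    qed
    then show ?thesis by auto
  qed
  have G3: "G \<subseteq> Pow (insert x ?K)" unfolding G_def by blast
  have G4: "\<exists>y\<in>B. x \<in> ancestors y \<and> {z \<in> ancestors y. x \<in> ancestors z} \<subseteq> R" if "R \<in> G" for R
  proof -
    obtain R' where R': "R = insert x R'" "R' \<in> Pow ?K - ?A"
      using \<open>R \<in> G\<close> unfolding G_def by (rule imageE)
    then obtain c where R: "R = insert x R'" "c \<in> C" "R' \<inter> J c \<in> E c" by auto
    obtain y where y: "y \<in> B" "c \<in> ancestors y" "{z \<in> ancestors y. c \<in> ancestors z} \<subseteq> R' \<inter> J c"
      using path[OF R(2,3)] by blast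
    have xc: "x \<in> ancestors c" using ancestors_children[OF ch[OF R(2)]] by simp
    \<comment> \<open>The path from \<open>x\<close> to \<open>y\<close> consists of
      \<open>x\<close> and the path from \<open>c\<close> to \<open>y\<close>.\<close>
    have "z \<in> R" if z: "z \<in> ancestors y" "x \<in> ancestors z" for z
    proof (cases "c \<le> z")
      case True
      then have "c \<in> ancestors z" using ancestors_linear[OF z(1) y(2)] by simp
      then show ?thesis using y(3) z(1) R(1) by blast
    next
      case False
      then have "z \<in> ancestors c" "z \<noteq> c" using ancestors_linear[OF y(2) z(1)] by simp_all
      then have "z \<in> ancestors x" using ancestors_children[OF ch[OF R(2)]] by simp
      then have "z = x" using ancestors_le z(2) by (meson order_antisym)
      then show ?thesis using R(1) by simp
    qed
    then show ?thesis using y(1) ancestors_trans[OF xc y(2)] by blast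
  qed
  have "finite (insert x ?K)" using finK by (rule finite.insertI)
  with G1 G2 G3 G4 show ?case by (intro exI[of _ "insert x ?K"] exI[of _ G] conjI ballI)
qed

section \<open>The initial forbidden set and compactness\<close>

definition uncoverable :: "bool list set \<Rightarrow> nat set" where
  "uncoverable W = {y. \<forall>R. ancestors y \<subseteq> R \<longrightarrow> R \<in> open_of W}"

text \<open>Otherwise an event of probability at least 1/4 would lie in \<open>open_of W\<close>,
  and by compactness in finitely many cylinders of total measure at most 1/8.\<close>

lemma not_big_uncoverable:
  assumes W: "\<And>F. finite F \<Longrightarrow> F \<subseteq> W \<Longrightarrow> (\<Sum>w\<in>F. (1/2::real) ^ length w) \<le> 1/8"
  shows "\<not> big 3 (uncoverable W) 0"
proof
  assume "big 3 (uncoverable W) 0"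
  from big_probability[OF this] obtain J E where J: "finite J" and E: "E \<subseteq> Pow J"
    "2 ^ card J \<le> 4 * card E" "\<And>R. R \<in> E \<Longrightarrow> \<exists>y\<in>uncoverable W. ancestors y \<subseteq> R"
    by auto
  have cover: "R \<in> open_of W" if "R \<inter> J \<in> E" for R
    using E(3)[OF that] unfolding uncoverable_def by blast
  define V where "V n = {w \<in> W. length w \<le> n}" for n
  \<comment> \<open>Compactness: a cluster point of counterexamples still satisfies the event, which
    depends only on the finite set \<open>J\<close>. It thus lies in some cylinder of
    \<open>W\<close>, and so do counterexamples of large index.\<close>
  have "\<exists>n. \<forall>R. R \<inter> J \<in> E \<longrightarrow> R \<in> open_of (V n)"
  proof (rule ccontr)
    assume "\<not> ?thesis"
    then have "\<forall>n. \<exists>R. R \<inter> J \<in> E \<and> R \<notin> open_of (V n)" by blast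
    from choice[OF this] obtain R where R: "\<And>n. R n \<inter> J \<in> E" "\<And>n. R n \<notin> open_of (V n)" by blast
    obtain S where S: "\<And>m. infinite {n. R n \<inter> {..<m} = S \<inter> {..<m}}"
      using cluster_point[of R] by blast
    obtain b where b: "J \<subseteq> {..<b}" using J finite_nat_bounded by blast
    obtain n where "R n \<inter> {..<b} = S \<inter> {..<b}" using cluster_point_above[OF S[of b]] by blast
    then have "R n \<inter> J = S \<inter> J" using b by blast
    then have "S \<in> open_of W" using cover R(1)[of n] by simp
    then obtain w where w: "w \<in> W" "S \<in> cylinder w" by (auto simp: open_of_def)
    obtain n where n: "length w \<le> n" "R n \<inter> {..<length w} = S \<inter> {..<length w}"
      using cluster_point_above[OF S[of "length w"]] by blast
    then have "R n \<in> cylinder w" using w(2) cylinder_cong by blast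
    then show False using R(2)[of n] w(1) n(1) by (auto simp: open_of_def V_def)
  qed
  then obtain n where n: "\<And>R. R \<inter> J \<in> E \<Longrightarrow> R \<in> open_of (V n)" by blast
  have "finite (V n)"
    unfolding V_def using finite_lists_length_le[of "UNIV :: bool set" n] by (simp add: finite_subset)
  \<comment> \<open>Below \<open>b\<close> lie all positions on which the event and the strings in
    \<open>V n\<close> depend, so measures become counts of subsets of
    \<open>{..<b}\<close>.\<close>
  obtain b where b: "J \<union> {..<n} \<subseteq> {..<b}" using J finite_nat_bounded[of "J \<union> {..<n}"] by blast
  let ?M = "{R. R \<subseteq> {..<b} \<and> R \<inter> J \<in> E}" and ?Cyl = "\<lambda>w. {R. R \<subseteq> {..<b} \<and> R \<in> cylinder w}"
  have card_cyl: "card (?Cyl w) = 2 ^ (b - length w)" if "w \<in> V n" for w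
  proof -
    let ?D = "{i. i < length w \<and> w ! i}"
    have "length w \<le> b" using that b unfolding V_def by (simp add: lessThan_subset_iff)
    have "R \<in> cylinder w \<longleftrightarrow> R \<inter> {..<length w} \<in> {?D}" for R
      unfolding cylinder_def by auto
    then have "?Cyl w = {R. R \<subseteq> {..<b} \<and> R \<inter> {..<length w} \<in> {?D}}" by simp
    also have "card \<dots> = card {?D} * 2 ^ (card {..<b} - card {..<length w})"
      using \<open>length w \<le> b\<close> by (intro card_restrict) auto
    finally show ?thesis by simp
  qed
  have cyl: "real (card (?Cyl w)) = 2 ^ b * (1/2) ^ length w" if "w \<in> V n" for w
  proof -
    have "length w \<le> b" using that b unfolding V_def by (simp add: lessThan_subset_iff)
    then have "(2::real) ^ (b - length w) = 2 ^ b * (1/2) ^ length w"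
      by (simp add: power_diff power_one_over)
    then show ?thesis by (simp only: card_cyl[OF that] of_nat_power of_nat_numeral)
  qed
  have "card E * 2 ^ (b - card J) = card ?M"
    using card_restrict[of "{..<b}" J E] b E(1) by simp
  also have "\<dots> \<le> card (\<Union>w\<in>V n. ?Cyl w)"
    using n \<open>finite (V n)\<close> by (intro card_mono) (auto simp: open_of_def)
  also have "\<dots> \<le> (\<Sum>w\<in>V n. card (?Cyl w))" by (rule card_UN_le[OF \<open>finite (V n)\<close>])
  finally have "real (card E * 2 ^ (b - card J)) \<le> real (\<Sum>w\<in>V n. card (?Cyl w))"
    by (rule of_nat_mono)
  also have "\<dots> = 2 ^ b * (\<Sum>w\<in>V n. (1/2) ^ length w)"
    unfolding of_nat_sum sum_distrib_left by (rule sum.cong[OF refl cyl])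
  also have "\<dots> \<le> 2 ^ b * (1/8)"
    using W[OF \<open>finite (V n)\<close>] by (intro mult_left_mono) (auto simp: V_def)
  finally have le: "real (card E * 2 ^ (b - card J)) \<le> 2 ^ b * (1/8)" .
  have "card J \<le> b" using card_mono[of "{..<b}" J] b by simp
  then have "(2::nat) ^ b = 2 ^ card J * 2 ^ (b - card J)" by (simp flip: power_add)
  also have "\<dots> \<le> 4 * (card E * 2 ^ (b - card J))"
    using E(2) by (simp add: mult.assoc[symmetric])
  finally have "real (2 ^ b) \<le> real (4 * (card E * 2 ^ (b - card J)))" by (rule of_nat_mono)
  then have "(2::real) ^ b \<le> 4 * real (card E * 2 ^ (b - card J))" by simp
  moreover have "(0::real) < 2 ^ b" by simp
  ultimately show False using le by linarith
qed

text \<open>Supersets of the single paths outside the open set have a cluster point. It stays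
  outside since the complement is closed, and it contains every path since later supersets
  do.\<close>

lemma superset_outside_open:
  fixes x :: "nat \<Rightarrow> nat"
  assumes "\<And>n. x n \<notin> uncoverable W" "\<And>m n. m \<le> n \<Longrightarrow> x m \<in> ancestors (x n)"
  shows "\<exists>S. S \<notin> open_of W \<and> (\<Union>n. ancestors (x n)) \<subseteq> S"
proof -
  have "\<forall>n. \<exists>R. ancestors (x n) \<subseteq> R \<and> R \<notin> open_of W"
    using assms(1) by (auto simp: uncoverable_def)
  from choice[OF this] obtain R where R: "\<And>n. ancestors (x n) \<subseteq> R n" "\<And>n. R n \<notin> open_of W" by blast
  obtain S where S: "\<And>m. infinite {n. R n \<inter> {..<m} = S \<inter> {..<m}}"
    using cluster_point[of R] by blast
  have "S \<notin> open_of W"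
  proof
    assume "S \<in> open_of W"
    then obtain w where w: "w \<in> W" "S \<in> cylinder w" by (auto simp: open_of_def)
    obtain n where "R n \<inter> {..<length w} = S \<inter> {..<length w}"
      using cluster_point_above[OF S[of "length w"]] by blast
    then have "R n \<in> cylinder w" using w(2) cylinder_cong by blast
    then show False using R(2)[of n] w(1) by (auto simp: open_of_def)
  qed
  moreover have "y \<in> S" if y: "y \<in> ancestors (x m)" for y m
  proof -
    obtain n where n: "m \<le> n" "R n \<inter> {..<Suc y} = S \<inter> {..<Suc y}"
      using cluster_point_above[OF S[of "Suc y"]] by blast
    have "y \<in> R n" using ancestors_trans[OF y assms(2)[OF n(1)]] R(1) by blast
    then show ?thesis using n(2) by blast
  qed
  ultimately show ?thesis by blast
qed

section \<open>Forcing\<close>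

definition defined_below :: "prog \<Rightarrow> nat \<Rightarrow> nat set" where
  "defined_below p i =
    {y. \<forall>m<i. \<exists>b. bounded_eval (ancestors y) y p [m] = Suc (of_bool b)}"

text \<open>The first case puts any set computed by \<open>p\<close> from a branch through
  \<open>x\<close> into level \<open>j\<close> of the test. In the second, an infinite branch
  avoiding \<open>B\<close> never determines the first \<open>i\<close> bits, so \<open>p\<close>
  computes no set from it.\<close>

definition forces :: "nat \<Rightarrow> nat set \<Rightarrow> prog \<Rightarrow> nat \<Rightarrow> bool" where
  "forces x B p j \<longleftrightarrow>
    (\<exists>w\<in>capture p j. \<exists>y\<in>ancestors x.
      \<forall>m<length w. bounded_eval (ancestors y) y p [m] = Suc (of_bool (w ! m))) \<or>
    (\<exists>i. defined_below p i \<subseteq> B)"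

lemma forcing_step:
  assumes "\<not> big k B x"
  shows "\<exists>x' k' B'. \<not> big k' B' x' \<and> x \<in> ancestors x' \<and> x < x' \<and> B \<subseteq> B' \<and> forces x' B' p j"
proof -
  \<comment> \<open>Coding \<open>k\<close> and \<open>x\<close> into the length reserves one string
    length of level \<open>j\<close> for this condition.\<close>
  define i where "i = Suc j + prod_encode (k, x)"
  \<comment> \<open>A final move to a child makes the node strictly larger, which will make the
    branch infinite.\<close>
  have *: "\<exists>c. y \<in> ancestors c \<and> y < c \<and> \<not> big l B' c" if "\<not> big l B' y" for l B' y
    using not_big_child[OF that] children_greater ancestors_children by (metis ancestors_refl insertCI)
  show ?thesis
  proof (cases "big (k * 2 ^ i) (defined_below p i) x")
    case True
    then obtain w y where wy: "w \<in> capture p j" "x \<in> ancestors y" "\<not> big k B y"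
      "\<forall>m<length w. bounded_eval (ancestors y) y p [m] = Suc (of_bool (w ! m))"
      using capture_extend[OF assms, of j p] unfolding i_def defined_below_def by blast
    obtain c where c: "y \<in> ancestors c" "y < c" "\<not> big k B c" using *[OF wy(3)] by blast
    have "forces c B p j" using wy(1,4) c(1) unfolding forces_def by blast
    moreover have "x < c" using ancestors_le[OF wy(2)] c(2) by simp
    ultimately show ?thesis using c(3) ancestors_trans[OF wy(2) c(1)] by blast
  next
    case False
    \<comment> \<open>Forbidding a further small set adds the two bushiness parameters.\<close>
    then have "\<not> big (k * 2 ^ i + k) (defined_below p i \<union> B) x"
      using big_Un assms by blast
    from *[OF this] obtain c where "x \<in> ancestors c" "x < c"
      "\<not> big (k * 2 ^ i + k) (defined_below p i \<union> B) c" by blast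
    moreover have "forces c (defined_below p i \<union> B) p j" unfolding forces_def by blast
    ultimately show ?thesis by blast
  qed
qed

lemma forcing_sequence:
  assumes "\<not> big k B 0"
  obtains x C where "\<And>n. x n \<in> ancestors (x (Suc n))" "\<And>n. x n < x (Suc n)"
    "\<And>n. C n \<subseteq> C (Suc n)" "\<And>n. x n \<notin> C n" "B \<subseteq> C 0"
    "\<And>p j. \<exists>n. forces (x n) (C n) p j"
proof -
  let ?P = "\<lambda>(x, k, C). \<not> big k C x \<and> B \<subseteq> C"
  \<comment> \<open>Stage \<open>n\<close> treats the program and the level coded by
    \<open>n\<close>.\<close>
  let ?Q = "\<lambda>n (x, k, C) (x', k', C'). x \<in> ancestors x' \<and> x < x' \<and> C \<subseteq> C' \<and>
    (case from_nat n of (p :: prog, j :: nat) \<Rightarrow> forces x' C' p j)"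
  have "\<exists>f. \<forall>n. ?P (f n) \<and> ?Q n (f n) (f (Suc n))"
  proof (rule dependent_nat_choice)
    show "\<exists>s. ?P s" using assms by (intro exI[of _ "(0, k, B)"]) simp
    fix s n assume s: "?P s"
    obtain x k C where xkC: "s = (x, k, C)" by (cases s)
    obtain p j where pj: "from_nat n = (p :: prog, j :: nat)" by fastforce
    obtain x' k' C' where "\<not> big k' C' x'" "x \<in> ancestors x'" "x < x'" "C \<subseteq> C'" "forces x' C' p j"
      using forcing_step[of k C x] s xkC by blast
    then show "\<exists>s'. ?P s' \<and> ?Q n s s'" using s xkC pj by (intro exI[of _ "(x', k', C')"]) auto
  qed
  then obtain f where "\<forall>n. ?P (f n) \<and> ?Q n (f n) (f (Suc n))" ..
  note f = this[THEN spec, THEN conjunct1] this[THEN spec, THEN conjunct2]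
  define x k C where "x n = fst (f n)" and "k n = fst (snd (f n))" and "C n = snd (snd (f n))" for n
  have f_eq: "f n = (x n, k n, C n)" for n by (simp add: x_def k_def C_def)
  have small: "\<not> big (k n) (C n) (x n)" "B \<subseteq> C n" for n
    using f(1)[of n] by (simp_all add: f_eq)
  show ?thesis
  proof (rule that[of x C])
    show "x n \<in> ancestors (x (Suc n))" "x n < x (Suc n)" "C n \<subseteq> C (Suc n)" for n
      using f(2)[of n] by (simp_all add: f_eq)
    \<comment> \<open>A forbidden node would itself be a leaf, so the forbidden set would be big
      above it.\<close>
    show "x n \<notin> C n" for n using small(1) by (blast intro: big.leaf)
    show "B \<subseteq> C 0" by (rule small(2))
    fix p j
    have "forces (x (Suc n)) (C (Suc n)) p j" if "n = to_nat (p, j)" for n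
      using f(2)[of n] by (simp add: f_eq that)
    then show "\<exists>n. forces (x n) (C n) p j" by blast
  qed
qed

theorem theorem3p8:
  shows "\<exists>R Y. ml_random R \<and> infinite Y \<and> Y \<subseteq> R \<and> \<not> (\<exists>X. ml_random X \<and> X \<le>\<^sub>T Y)"
proof -
  obtain W where W: "\<And>X. X \<notin> open_of W \<Longrightarrow> ml_random X"
    "\<And>F. finite F \<Longrightarrow> F \<subseteq> W \<Longrightarrow> (\<Sum>w\<in>F. (1/2::real) ^ length w) \<le> 1/8"
    using random_complement by blast
  obtain x C where x: "\<And>n. x n \<in> ancestors (x (Suc n))" "\<And>n. x n < x (Suc n)"
    and C: "\<And>n. C n \<subseteq> C (Suc n)" "\<And>n. x n \<notin> C n" "uncoverable W \<subseteq> C 0"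
    and forces: "\<And>p j. \<exists>n. forces (x n) (C n) p j"
    using forcing_sequence[OF not_big_uncoverable[OF W(2)]] by blast
  have anc: "x m \<in> ancestors (x n)" if "m \<le> n" for m n
    using that by (induction rule: dec_induct) (use x(1) ancestors_trans in \<open>auto intro: ancestors_trans\<close>)
  have C_mono: "C m \<subseteq> C n" if "m \<le> n" for m n
    using that C(1) by (rule lift_Suc_mono_le[rotated])
  have x_ge: "n \<le> x n" for n
    using x(2) by (intro strict_mono_imp_increasing) (rule strict_mono_Suc_iff[THEN iffD2], simp)
  define Y where "Y = (\<Union>n. ancestors (x n))"
  have xY: "x n \<in> Y" for n unfolding Y_def using ancestors_refl by blast
  have "infinite Y" unfolding infinite_nat_iff_unbounded_le using xY x_ge by blast
  \<comment> \<open>Two elements of \<open>Y\<close> lie on a common path, so the smaller one is an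
    ancestor of the larger one.\<close>
  have Y: "ancestors y \<inter> {..y} = Y \<inter> {..y}" if y: "y \<in> Y" for y
  proof (intro equalityI subsetI)
    obtain m where m: "y \<in> ancestors (x m)" using y unfolding Y_def by blast
    show "z \<in> Y \<inter> {..y}" if "z \<in> ancestors y \<inter> {..y}" for z
      using that ancestors_trans[OF _ m] unfolding Y_def by blast
    fix z assume z: "z \<in> Y \<inter> {..y}"
    then obtain n where "z \<in> ancestors (x n)" unfolding Y_def by blast
    then have "z \<in> ancestors (x (max m n))" "y \<in> ancestors (x (max m n))"
      using m anc ancestors_trans by (meson max.cobounded1 max.cobounded2)+
    then show "z \<in> ancestors y \<inter> {..y}" using ancestors_linear[of y "x (max m n)" z] z by simp
  qed
  \<comment> \<open>With \<open>y\<close> as its own bound, evaluation at a node of \<open>Y\<close>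
    agrees with evaluation from the whole of \<open>Y\<close>.\<close>
  have node: "bounded_eval (ancestors y) y p xs = bounded_eval Y y p xs" if "y \<in> Y" for y p xs
    using bounded_eval_cong[OF Y[OF that]] by simp
  obtain R where "R \<notin> open_of W" "Y \<subseteq> R"
    using superset_outside_open[of x W] anc C(2,3) C_mono unfolding Y_def by blast
  moreover have "\<not> ml_random X" if "X \<le>\<^sub>T Y" for X
  proof -
    obtain p where p: "\<And>n. eval Y p [n] (of_bool (n \<in> X))"
      using \<open>X \<le>\<^sub>T Y\<close> unfolding turing_reducible_def by blast
    have "X \<in> open_of (capture p j)" for j
    proof -
      obtain n where "forces (x n) (C n) p j" using forces by blast
      then consider (capture) w y where "w \<in> capture p j" "y \<in> ancestors (x n)"
          "\<And>m. m < length w \<Longrightarrow> bounded_eval (ancestors y) y p [m] = Suc (of_bool (w ! m))"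
        | (diverge) i where "defined_below p i \<subseteq> C n"
        unfolding forces_def by blast
      then show ?thesis
      proof cases
        case capture
        have "y \<in> Y" using capture(2) unfolding Y_def by blast
        then have "eval Y p [m] (of_bool (w ! m))" if "m < length w" for m
          using capture(3)[OF that] node bounded_eval_sound by simp
        then have "of_bool (w ! m) = (of_bool (m \<in> X) :: nat)" if "m < length w" for m
          using eval_deterministic[OF _ p] that by blast
        then have "w ! m \<longleftrightarrow> m \<in> X" if "m < length w" for m
          using that by (simp only: of_bool_eq_iff)
        then have "X \<in> cylinder w" by (simp add: cylinder_def)
        with capture(1) show ?thesis unfolding open_of_def by blast
      next
        case diverge
        have "\<forall>\<^sub>F b in sequentially. \<forall>m\<in>{..<i}. bounded_eval Y b p [m] = Suc (of_bool (m \<in> X))"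
          by (intro eventually_ball_finite ballI bounded_eval_complete p) simp
        then obtain b0 where b0:
          "\<And>b m. b0 \<le> b \<Longrightarrow> m < i \<Longrightarrow> bounded_eval Y b p [m] = Suc (of_bool (m \<in> X))"
          unfolding eventually_sequentially by blast
        \<comment> \<open>This stage is late enough for the first \<open>i\<close> bits to be
          determined and for \<open>C n\<close> to be forbidden.\<close>
        have "b0 \<le> x (max n b0)" using x_ge[of "max n b0"] by simp
        then have "x (max n b0) \<in> defined_below p i"
          using b0 node[OF xY] unfolding defined_below_def by auto
        then have "x (max n b0) \<in> C (max n b0)" using diverge C_mono[of n "max n b0"] by auto
        with C(2) show ?thesis by blast
      qed
    qed
    then show ?thesis using ml_test_capture unfolding ml_random_def by blast
  qed
  ultimately show ?thesis using W(1) \<open>infinite Y\<close> by blast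
qed

end
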